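(* Let $n$ be a positive integer. For all $\theta\in S_n$ such that $\frac{n}{2}-\ell(\theta)+2>0$ we have $$|\mathrm{Map}_n(\theta)|=\frac{|\mathrm{GJdM}_n(\theta)|}{\frac{n}{2}-\ell(\theta)+2}.$$
   Context: Let $\langle n\rangle=\{1,\dots,n\}$ and let $S_n$ be the group of permutations of $\langle n\rangle$. For $\sigma\in S_n$, $\ell(\sigma)$ denotes the number of orbits of $\sigma$ on $\langle n\rangle$ (fixed points count as orbits), and $\mathrm{supp}\,\sigma=\{i\in\langle n\rangle\mid\sigma(i)\neq i\}$. $\mathrm{Map}_n(\theta)$ is the set of $\iota\in S_n$ such that: (1) $\iota$ is fixed-point-free and squares to the identity; (2) $\ell(\theta)-\ell(\iota)+\ell(\theta\iota)=2$; (3) $\theta$ and $\iota$ generate a subgroup of $S_n$ acting transitively on $\langle n\rangle$. $\mathrm{GJ}_n$ is the set of pairs $(\theta,\sigma)\in S_n\times S_n$ with $\ell(\theta)+\ell(\sigma)=n+1$ and $\ell(\theta\sigma)=1$. For $(\theta,\sigma)\in\mathrm{GJ}_n$, $\mathrm{dMotz}_n(\theta,\sigma)$ is the set of functions $g:\langle n\rangle\to\mathbb{Z}$ such that: $|g|\leq 1$; $g$ averages to $0$ on each $\theta$-orbit; $g\circ\sigma=g$; $\{g=-1\}\cap\mathrm{supp}\,\sigma=\emptyset$; $\{g=0\}\cap\mathrm{supp}\,\sigma^2=\emptyset$; $\{g=0\}\subset\mathrm{supp}\,\sigma$. Here $\{g=c\}=\{i\in\langle n\rangle\mid g(i)=c\}$.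 $\mathrm{GJdM}_n(\theta)$ is the set of pairs $(\sigma,g)$ with $\sigma\in S_n$, $(\theta,\sigma)\in\mathrm{GJ}_n$ and $g\in\mathrm{dMotz}_n(\theta,\sigma)$. *)

theory Defs
  imports Complex_Main "HOL-Library.FuncSet" "HOL-Combinatorics.Orbits" "HOL-Algebra.Sym_Groups"
begin

text \<open>
  Elements of \<open>S\<^sub>n\<close> are the functions \<open>nat \<Rightarrow> nat\<close> that permute \<open>{1..n}\<close> (and fix every other
  number); the product is composition. Hence all notions below are cut down to \<open>{1..n}\<close>.
\<close>

definition perm_orbits :: "nat \<Rightarrow> (nat \<Rightarrow> nat) \<Rightarrow> nat set set" where
  "perm_orbits n \<sigma> = Orbits.orbit \<sigma> ` {1..n}"

definition num_orbits :: "nat \<Rightarrow> (nat \<Rightarrow> nat) \<Rightarrow> nat" where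
  "num_orbits n \<sigma> = card (perm_orbits n \<sigma>)"

definition supp :: "nat \<Rightarrow> (nat \<Rightarrow> nat) \<Rightarrow> nat set" where
  "supp n \<sigma> = {i \<in> {1..n}. \<sigma> i \<noteq> i}"

definition level_set :: "nat \<Rightarrow> (nat \<Rightarrow> int) \<Rightarrow> int \<Rightarrow> nat set" where
  "level_set n g c = {i \<in> {1..n}. g i = c}"

definition generate_transitive :: "nat \<Rightarrow> (nat \<Rightarrow> nat) set \<Rightarrow> bool" where
  "generate_transitive n A \<longleftrightarrow>
     (\<forall>x \<in> {1..n}. \<forall>y \<in> {1..n}. \<exists>h \<in> generate (sym_group n) A. h x = y)"

definition Map :: "nat \<Rightarrow> (nat \<Rightarrow> nat) \<Rightarrow> (nat \<Rightarrow> nat) set" where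
  "Map n \<theta> = {\<iota>. \<iota> permutes {1..n} \<and>
     (\<forall>i \<in> {1..n}. \<iota> i \<noteq> i) \<and> \<iota> \<circ> \<iota> = id \<and>
     int (num_orbits n \<theta>) - int (num_orbits n \<iota>) + int (num_orbits n (\<theta> \<circ> \<iota>)) = 2 \<and>
     generate_transitive n {\<theta>, \<iota>}}"

definition GJ :: "nat \<Rightarrow> ((nat \<Rightarrow> nat) \<times> (nat \<Rightarrow> nat)) set" where
  "GJ n = {(\<theta>, \<sigma>). \<theta> permutes {1..n} \<and> \<sigma> permutes {1..n} \<and>
     num_orbits n \<theta> + num_orbits n \<sigma> = n + 1 \<and> num_orbits n (\<theta> \<circ> \<sigma>) = 1}"

text \<open>
  Functions \<open>\<langle>n\<rangle> \<rightarrow> \<int>\<close> are extensional (\<open>undefined\<close> outside \<open>{1..n}\<close>), so that each is counted once.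
  The equation \<open>g \<circ> \<sigma> = g\<close> then only constrains \<open>g\<close> on \<open>{1..n}\<close>, as \<open>\<sigma>\<close> is the identity elsewhere.
\<close>

definition dMotz :: "nat \<Rightarrow> (nat \<Rightarrow> nat) \<Rightarrow> (nat \<Rightarrow> nat) \<Rightarrow> (nat \<Rightarrow> int) set" where
  "dMotz n \<theta> \<sigma> = {g \<in> {1..n} \<rightarrow>\<^sub>E UNIV.
     (\<forall>i \<in> {1..n}. \<bar>g i\<bar> \<le> 1) \<and>
     (\<forall>C \<in> perm_orbits n \<theta>. (\<Sum>i\<in>C. real_of_int (g i)) / real (card C) = 0) \<and>
     g \<circ> \<sigma> = g \<and>
     level_set n g (-1) \<inter> supp n \<sigma> = {} \<and>
     level_set n g 0 \<inter> supp n (\<sigma> \<circ> \<sigma>) = {} \<and>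
     level_set n g 0 \<subseteq> supp n \<sigma>}"

definition GJdM :: "nat \<Rightarrow> (nat \<Rightarrow> nat) \<Rightarrow> ((nat \<Rightarrow> nat) \<times> (nat \<Rightarrow> int)) set" where
  "GJdM n \<theta> = {(\<sigma>, g). \<sigma> permutes {1..n} \<and> (\<theta>, \<sigma>) \<in> GJ n \<and> g \<in> dMotz n \<theta> \<sigma>}"

text \<open>Both sets are finite, so \<open>card\<close> is their number of elements.\<close>

lemma finite_Map: "finite (Map n \<theta>)"
  by (rule finite_subset[OF _ finite_permutations[of "{1..n}"]]) (auto simp: Map_def)

lemma finite_GJdM: "finite (GJdM n \<theta>)"
proof (rule finite_subset)
  show "GJdM n \<theta> \<subseteq> {\<sigma>. \<sigma> permutes {1..n}} \<times> ({1..n} \<rightarrow>\<^sub>E {-1..1})"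
    unfolding GJdM_def dMotz_def by (auto simp: PiE_iff extensional_def abs_le_iff minus_le_iff)
  show "finite ({\<sigma>. \<sigma> permutes {1..n}} \<times> ({1..n} \<rightarrow>\<^sub>E {-1..1::int}))"
    by (intro finite_cartesian_product finite_permutations finite_PiE) auto
qed

end

theory Submission
  imports Defs
begin

text \<open>
  The triple \<open>(\<theta>, \<iota>, \<theta> \<circ> \<iota>)\<close> is a map drawn on a surface: the numbers \<open>1, \<dots>, n\<close> are its half-edges,
  \<open>\<theta>\<close> turns around the vertices, \<open>\<iota>\<close> swaps the two halves of every edge and \<open>\<phi> = \<theta> \<circ> \<iota>\<close> walks around
  the faces. For \<open>\<iota>\<close> in \<open>Map n \<theta>\<close> the number of edges is \<open>n / 2\<close>, so Euler's relation in \<open>Map\<close> says that the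
  map has exactly \<open>n / 2 - num_orbits n \<theta> + 2\<close> faces. The theorem thus states that \<open>GJdM n \<theta>\<close> has as
  many elements as there are maps with a distinguished face. The bijection behind it is (the dual
  form of) the mobile bijection of Bouttier, Di Francesco and Guitter.

  A distinguished face gives every half-edge \<open>x\<close> a height \<open>L x\<close>, the distance in the dual graph from
  that face to the face of \<open>x\<close>. The edge of \<open>x\<close> separates the face of \<open>x\<close> from that of \<open>\<theta> x\<close>, and
  \<open>g x = L x - L (\<theta> x)\<close>, which is \<open>-1\<close>, \<open>0\<close> or \<open>1\<close>, is the height lost by crossing it. Distances are
  characterised by two properties: height \<open>0\<close> is a single face, and every other face has a
  half-edge with \<open>g = 1\<close> (\<open>dual_distance\<close>, \<open>dual_distance_le\<close>). From now on \<open>L\<close> is fixed.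

  The mobile \<open>\<sigma>\<close> of the map equals \<open>\<iota>\<close> on the half-edges with \<open>g = 0\<close>, fixes those with \<open>g = -1\<close>, and
  links those with \<open>g = 1\<close> into one cycle per face, in the order opposite to \<open>\<phi>\<close>. The main point
  (\<open>descent_return\<close>) is how the contour \<open>\<psi> = \<theta> \<circ> \<sigma>\<close> sees the faces: if \<open>g x \<le> 0\<close>, then \<open>\<phi> x\<close> is the
  first point after \<open>x\<close> on the contour whose height is at most \<open>L x\<close>. In particular the contour
  visits everything, so \<open>\<psi>\<close> is one cycle. Conversely this description recovers \<open>\<iota>\<close> from \<open>\<sigma>\<close>: along
  any cyclic contour with steps of height \<open>-1\<close>, \<open>0\<close>, \<open>1\<close> the ascents are matched with the descents like
  opening and closing brackets (\<open>map_exists\<close>). Every cycle of \<open>\<sigma>\<close> with \<open>g = 1\<close> then lies in a face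
  of its own, and only the face of height \<open>0\<close> has none. So \<open>\<sigma>\<close> has \<open>n / 2\<close> orbits with \<open>g \<le> 0\<close> and
  one for each face but one (\<open>card_orbits_corresponds\<close>), and Euler's relation for \<open>\<iota>\<close> becomes the
  relation \<open>num_orbits n \<theta> + num_orbits n \<sigma> = n + 1\<close>.

  An element of \<open>GJdM n \<theta>\<close> carries \<open>g\<close> instead of \<open>L\<close>. By that last relation the orbits of \<open>\<theta>\<close>
  and \<open>\<sigma>\<close> are the vertices of a tree whose edges are the half-edges, and on a tree a function
  with sum \<open>0\<close> around each \<open>\<theta>\<close>-orbit is the difference \<open>L - L \<circ> \<theta>\<close> of a \<open>\<sigma>\<close>-invariant \<open>L\<close> (\<open>potential_exists\<close>), which is unique once its
  minimum is \<open>0\<close>.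
\<close>

section \<open>Orbits and first returns\<close>

lemma orbit_eq_iff:
  assumes "permutation f"
  shows "orbit f x = orbit f y \<longleftrightarrow> y \<in> orbit f x"
  by (metis assms orbit_cyclic_eq3 cyclic_on_orbit' permutation_self_in_orbit)

lemma orbit_closed:
  assumes "y \<in> orbit f x" "Q x" "\<And>z. Q z \<Longrightarrow> Q (f z)"
  shows "Q y"
  using assms(1) by induct (auto intro: assms)

text \<open>
  Every point after the start avoids \<open>P\<close>; the start itself may satisfy it. As a reflexive
  transitive closure, paths can be concatenated and taken apart at both ends.
\<close>

definition avoiding_path :: "('a \<Rightarrow> 'a) \<Rightarrow> ('a \<Rightarrow> bool) \<Rightarrow> 'a \<Rightarrow> 'a \<Rightarrow> bool" where
  "avoiding_path f P = (\<lambda>a b. b = f a \<and> \<not> P b)\<^sup>*\<^sup>*"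

text \<open>
  A relation and not a function, since the contour is observed through predicates \<open>P\<close> that vary
  with the starting point \<open>x\<close>.
\<close>

definition first_return :: "('a \<Rightarrow> 'a) \<Rightarrow> ('a \<Rightarrow> bool) \<Rightarrow> 'a \<Rightarrow> 'a \<Rightarrow> bool" where
  "first_return f P x y \<longleftrightarrow> P y \<and> (\<exists>z. avoiding_path f P x z \<and> f z = y)"

lemma avoiding_path_refl [simp]: "avoiding_path f P x x"
  by (simp add: avoiding_path_def)

lemma avoiding_path_induct [consumes 1, case_names base step]:
  assumes "avoiding_path f P x y" "Q x"
    and "\<And>v. avoiding_path f P x v \<Longrightarrow> \<not> P (f v) \<Longrightarrow> Q v \<Longrightarrow> Q (f v)"
  shows "Q y"
  using assms unfolding avoiding_path_def by (induct rule: rtranclp_induct) auto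

lemma avoiding_path_trans:
  "avoiding_path f P x y \<Longrightarrow> avoiding_path f P y z \<Longrightarrow> avoiding_path f P x z"
  by (simp add: avoiding_path_def)

lemma avoiding_path_step:
  "avoiding_path f P x y \<Longrightarrow> \<not> P (f y) \<Longrightarrow> avoiding_path f P x (f y)"
  by (simp add: avoiding_path_def rtranclp.rtrancl_into_rtrancl)

lemma avoiding_path_mono:
  assumes "avoiding_path f P x y" "\<And>a. Q a \<Longrightarrow> P a"
  shows "avoiding_path f Q x y"
  using assms(1) unfolding avoiding_path_def
  by (rule rtranclp_mono[THEN predicate2D, rotated]) (use assms(2) in auto)

lemma avoiding_path_end: "avoiding_path f P x y \<Longrightarrow> y = x \<or> \<not> P y"
  unfolding avoiding_path_def by (induct rule: rtranclp_induct) auto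

lemma avoiding_path_in_orbit: "avoiding_path f P x y \<Longrightarrow> y = x \<or> y \<in> orbit f x"
  unfolding avoiding_path_def
  by (induct rule: rtranclp_induct) (auto intro: orbit.intros)

lemma first_return_in_orbit: "first_return f P x y \<Longrightarrow> y \<in> orbit f x"
  unfolding first_return_def by (auto dest!: avoiding_path_in_orbit intro: orbit.intros)

text \<open>
  A path that can be left at \<open>z\<close>, because \<open>f z\<close> satisfies \<open>P\<close>, has no continuation beyond \<open>z\<close>.
\<close>

lemma avoiding_path_last_unique:
  assumes "avoiding_path f P x z" "P (f z)" "avoiding_path f P x z'" "P (f z')"
  shows "z = z'"
  using assms unfolding avoiding_path_def
proof (induct rule: converse_rtranclp_induct)
  case base
  from base(2) show ?case
    by (cases rule: converse_rtranclpE) (use base in auto)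
next
  case (step a b)
  from step(5) show ?case
    by (cases rule: converse_rtranclpE) (use step in auto)
qed

lemma first_return_unique:
  "first_return f P x y \<Longrightarrow> first_return f P x y' \<Longrightarrow> y = y'"
  unfolding first_return_def using avoiding_path_last_unique by metis

text \<open>
  Read backwards from \<open>z\<close>, which is possible as \<open>f\<close> is injective, the start is the first point that
  satisfies \<open>P\<close>.
\<close>

lemma avoiding_path_start_unique:
  assumes "inj f" "P x" "P x'" "avoiding_path f P x z" "avoiding_path f P x' z"
  shows "x = x'"
  using assms(4,5) unfolding avoiding_path_def
proof (induct rule: rtranclp_induct)
  case base
  then show ?case
    by (cases rule: rtranclp.cases) (use assms in auto)
next
  case (step y z)
  from step(4) show ?case
    by (cases rule: rtranclp.cases) (use step assms in \<open>auto dest: injD\<close>)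
qed

lemma first_return_inj:
  assumes "inj f" "P x" "P x'" "first_return f P x y" "first_return f P x' y"
  shows "x = x'"
  using assms avoiding_path_start_unique[OF assms(1-3)] unfolding first_return_def
  by (metis injD)

lemma orbit_first_return_or_path:
  assumes "y \<in> orbit f x"
  shows "(\<exists>w. first_return f P x w) \<or> avoiding_path f P x y"
  using assms
proof induct
  case base
  then show ?case
    by (metis avoiding_path_refl avoiding_path_step first_return_def)
next
  case (step y)
  then show ?case by (metis avoiding_path_step first_return_def)
qed

lemma first_return_exists:
  assumes "y \<in> orbit f x" "P y"
  obtains w where "first_return f P x w"
proof -
  have "y = x \<Longrightarrow> \<exists>w. first_return f P x w" 
  proof -
    assume "y = x"
    from assms(1) have "(\<exists>w. first_return f P x w) \<or> (\<exists>v. avoiding_path f P x v \<and> f v = y)"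
      by cases (use orbit_first_return_or_path[of _ f x P] avoiding_path_refl in metis)+
    with assms(2) show ?thesis unfolding first_return_def by auto
  qed
  with orbit_first_return_or_path[OF assms(1), of P] avoiding_path_end[of f P x y] assms(2) that
  show thesis by metis
qed

lemma first_return_mono:
  assumes "first_return f P x y" "\<And>a. Q a \<Longrightarrow> P a" "Q y"
  shows "first_return f Q x y"
  using assms avoiding_path_mono[of f P x _ Q] unfolding first_return_def by metis

text \<open>
  If the returns to \<open>P\<close> from \<open>A\<close> lead to \<open>A\<close> again, then all that \<open>f\<close> visits between two returns is on
  an excursion that starts in \<open>A\<close>. Facts about a whole orbit thus reduce to facts about excursions.
\<close>

lemma orbit_covered_by_returns:
  assumes "x \<in> A" and t: "\<And>v. v \<in> A \<Longrightarrow> first_return f P v (t v) \<and> t v \<in> A"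
    and "w \<in> orbit f x"
  shows "\<exists>v\<in>A. avoiding_path f P v w"
proof -
  have step: "\<exists>v\<in>A. avoiding_path f P v (f w)" if "v \<in> A" "avoiding_path f P v w" for v w
  proof (cases "P (f w)")
    case True
    with that(2) have "first_return f P v (f w)" unfolding first_return_def by auto
    moreover have "first_return f P v (t v)" "t v \<in> A" using t[OF that(1)] by auto
    ultimately have "f w \<in> A" using first_return_unique by metis
    then show ?thesis using avoiding_path_refl by metis
  next
    case False
    with that show ?thesis using avoiding_path_step by metis
  qed
  from assms(3) show ?thesis
    by induct (use step assms(1) avoiding_path_refl in metis)+
qed

text \<open>
  Skipping the points outside \<open>P\<close> turns a cycle of \<open>f\<close> into a single cycle of the return map.
\<close>

lemma orbit_return_map:
  assumes P: "P x" and t: "\<And>y. P y \<Longrightarrow> first_return f P y (t y)" and "x \<in> orbit t x"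
  shows "orbit t x = {y \<in> orbit f x. P y}"
proof -
  have sub: "y \<in> orbit f x \<and> P y" if "y \<in> orbit t x" for y
    using that
  proof induct
    case base
    show ?case using t[OF P] first_return_in_orbit[OF t[OF P]] by (simp add: first_return_def)
  next
    case (step y)
    then have "P y" "y \<in> orbit f x" by auto
    moreover have "t y \<in> orbit f y" "P (t y)"
      using t[OF \<open>P y\<close>] first_return_in_orbit[OF t[OF \<open>P y\<close>]] by (auto simp: first_return_def)
    ultimately show ?case using orbit_trans by fastforce
  qed
  moreover have "y \<in> orbit t x" if "y \<in> orbit f x" "P y" for y
  proof -
    have "\<exists>v\<in>orbit t x. avoiding_path f P v y"
    proof (rule orbit_covered_by_returns[OF assms(3) _ that(1)])
      fix v assume v: "v \<in> orbit t x"
      with sub have "P v" by simp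
      with v t show "first_return f P v (t v) \<and> t v \<in> orbit t x" by (simp add: orbit.step)
    qed
    with that(2) avoiding_path_end[of f P _ y] show ?thesis by blast
  qed
  ultimately show ?thesis by auto
qed

section \<open>Orbits of involutions\<close>

lemma card_image_eq_iff:
  assumes "\<And>x y. x \<in> A \<Longrightarrow> y \<in> A \<Longrightarrow> f x = f y \<longleftrightarrow> g x = g y"
  shows "card (f ` A) = card (g ` A)"
proof -
  have "bij_betw (\<lambda>c. g (inv_into A f c)) (f ` A) (g ` A)"
    unfolding bij_betw_def
  proof
    show "inj_on (\<lambda>c. g (inv_into A f c)) (f ` A)"
      by (rule inj_onI) (metis assms f_inv_into_f inv_into_into)
    have "g (inv_into A f (f x)) = g x" if "x \<in> A" for x
      using that assms by (metis f_inv_into_f imageI inv_into_into)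
    then show "(\<lambda>c. g (inv_into A f c)) ` f ` A = g ` A"
      by (force simp: image_image)
  qed
  then show ?thesis by (rule bij_betw_same_card)
qed

lemma orbit_involution:
  assumes "f (f x) = x"
  shows "orbit f x = {x, f x}"
proof
  show "orbit f x \<subseteq> {x, f x}"
  proof
    fix y assume "y \<in> orbit f x"
    then show "y \<in> {x, f x}" by induct (use assms in auto)
  qed
  show "{x, f x} \<subseteq> orbit f x" using assms by (metis bot_least insert_subset orbit.intros)
qed

lemma card_orbits_involution:
  assumes "finite A" and f: "\<And>x. x \<in> A \<Longrightarrow> f x \<in> A \<and> f x \<noteq> x \<and> f (f x) = x"
  shows "2 * card (orbit f ` A) = card A"
proof -
  have orb: "orbit f x = {x, f x}" if "x \<in> A" for x
    using f[OF that] by (simp add: orbit_involution)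
  have "\<Union> (orbit f ` A) = A" using f by (auto simp: orb)
  moreover have "2 * card (orbit f ` A) = card (\<Union> (orbit f ` A))"
  proof (rule card_partition)
    fix c assume "c \<in> orbit f ` A"
    then obtain x where "x \<in> A" "c = {x, f x}" using orb by auto
    with f[of x] show "card c = 2" by auto
  next
    fix c d assume cd: "c \<in> orbit f ` A" "d \<in> orbit f ` A" "c \<noteq> d"
    have pair: "e = {z, f z}" if "e \<in> orbit f ` A" "z \<in> e" for e z
    proof -
      from that(1) obtain x where "x \<in> A" "e = {x, f x}" using orb by auto
      with f[OF \<open>x \<in> A\<close>] that(2) show ?thesis by (elim conjE) (simp, metis insert_commute)
    qed
    show "c \<inter> d = {}"
    proof (rule ccontr)
      assume "c \<inter> d \<noteq> {}"
      then obtain z where "z \<in> c" "z \<in> d" by auto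
      with pair[of c z] pair[of d z] cd show False by simp
    qed
  qed (use assms \<open>\<Union> (orbit f ` A) = A\<close> in auto)
  ultimately show ?thesis by simp
qed

section \<open>Maps and mobiles with the same heights\<close>

text \<open>
  The domain \<open>D\<close> is the set of half-edges and \<open>L x\<close> is the height of the face that contains \<open>x\<close>. Both
  the map and the mobile will be compatible with these heights, so that the correspondence can be
  studied for one fixed \<open>L\<close>.
\<close>

locale height_function =
  fixes D :: "'a set" and \<theta> :: "'a \<Rightarrow> 'a" and L :: "'a \<Rightarrow> int"
  assumes finite_D: "finite D"
    and \<theta>: "\<theta> permutes D"
    and L_nonneg: "\<And>x. x \<in> D \<Longrightarrow> 0 \<le> L x"
    and L_step: "\<And>x. x \<in> D \<Longrightarrow> \<bar>L x - L (\<theta> x)\<bar> \<le> 1"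
    and L_zero: "\<exists>x\<in>D. L x = 0"
begin

text \<open>
  The height lost by crossing the edge of \<open>x\<close>. Being \<open>L - L \<circ> \<theta>\<close>, it sums to \<open>0\<close> around each vertex.
\<close>

definition g :: "'a \<Rightarrow> int" where
  "g x = L x - L (\<theta> x)"

text \<open>
  Involutions that are compatible with the heights: by the last clause \<open>L\<close> is constant on the orbits
  of \<open>\<theta> \<circ> \<iota>\<close>, the faces.
\<close>

definition matching :: "('a \<Rightarrow> 'a) \<Rightarrow> bool" where
  "matching \<iota> \<longleftrightarrow> \<iota> permutes D \<and> (\<forall>x\<in>D. \<iota> x \<noteq> x) \<and> \<iota> \<circ> \<iota> = id \<and> (\<forall>x\<in>D. L (\<iota> x) = L (\<theta> x))"

text \<open>
  These two conditions hold exactly when \<open>L\<close> is the dual distance from a face: one face has height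
  \<open>0\<close>, and every other face has a neighbour one step lower.
\<close>

definition geodesic_map :: "('a \<Rightarrow> 'a) \<Rightarrow> bool" where
  "geodesic_map \<iota> \<longleftrightarrow> matching \<iota> \<and>
     (\<forall>x\<in>D. \<forall>y\<in>D. L x = 0 \<longrightarrow> L y = 0 \<longrightarrow> y \<in> orbit (\<theta> \<circ> \<iota>) x) \<and>
     (\<forall>x\<in>D. L x > 0 \<longrightarrow> (\<exists>y\<in>orbit (\<theta> \<circ> \<iota>) x. g y = 1))"

text \<open>
  Membership in \<open>GJdM\<close> in terms of heights, except for the number of orbits. That \<open>L\<close> is
  \<open>\<sigma>\<close>-invariant says that each cycle of \<open>\<sigma>\<close> belongs to a single height.
\<close>

definition mobile :: "('a \<Rightarrow> 'a) \<Rightarrow> bool" where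
  "mobile \<sigma> \<longleftrightarrow> \<sigma> permutes D \<and>
     (\<forall>x\<in>D. L (\<sigma> x) = L x \<and> g (\<sigma> x) = g x \<and> (g x = -1 \<longrightarrow> \<sigma> x = x) \<and>
        (g x = 0 \<longrightarrow> \<sigma> x \<noteq> x \<and> \<sigma> (\<sigma> x) = x)) \<and>
     (\<forall>x\<in>D. \<forall>y\<in>D. y \<in> orbit (\<theta> \<circ> \<sigma>) x)"

text \<open>
  On the half-edges with \<open>g = 1\<close> the permutation \<open>\<sigma>\<close> is the inverse of the return map of \<open>\<theta> \<circ> \<iota>\<close>,
  that is, it runs around each face against the sense of \<open>\<theta> \<circ> \<iota>\<close>. With this orientation
  \<open>\<theta> \<circ> \<sigma>\<close> is one cycle.
\<close>

definition corresponds :: "('a \<Rightarrow> 'a) \<Rightarrow> ('a \<Rightarrow> 'a) \<Rightarrow> bool" where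
  "corresponds \<iota> \<sigma> \<longleftrightarrow> \<sigma> permutes D \<and>
     (\<forall>x\<in>D. (g x = -1 \<longrightarrow> \<sigma> x = x) \<and> (g x = 0 \<longrightarrow> \<sigma> x = \<iota> x) \<and>
        (g x = 1 \<longrightarrow> g (\<sigma> x) = 1 \<and> first_return (\<theta> \<circ> \<iota>) (\<lambda>y. g y = 1) (\<sigma> x) x))"

text \<open>
  The face walk as seen from the contour \<open>\<theta> \<circ> \<sigma>\<close>. Half-edges with \<open>g = 1\<close> are left out: there \<open>\<iota>\<close> is
  already determined by its values on the half-edges with \<open>g = -1\<close>.
\<close>

definition descent_return :: "('a \<Rightarrow> 'a) \<Rightarrow> ('a \<Rightarrow> 'a) \<Rightarrow> bool" where
  "descent_return \<iota> \<sigma> \<longleftrightarrow>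
     (\<forall>x\<in>D. g x \<le> 0 \<longrightarrow> first_return (\<theta> \<circ> \<sigma>) (\<lambda>y. L y \<le> L x) x (\<theta> (\<iota> x)))"

lemma \<theta>_in: "\<theta> x \<in> D \<longleftrightarrow> x \<in> D"
  by (rule permutes_in_image[OF \<theta>])

lemma g_cases:
  assumes "x \<in> D"
  obtains "g x = -1" | "g x = 0" | "g x = 1"
  using L_step[OF assms] unfolding g_def by linarith

lemma g_nonpos: "x \<in> D \<Longrightarrow> g x \<noteq> 1 \<Longrightarrow> g x \<le> 0"
  using g_cases[of x] by force

lemma L_\<theta>: "L (\<theta> x) = L x - g x"
  by (simp add: g_def)

lemma L_pos: "x \<in> D \<Longrightarrow> g x = 1 \<Longrightarrow> L x > 0"
  using L_nonneg[of "\<theta> x"] \<theta>_in[of x] by (simp add: g_def)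

lemma permutation_D: "p permutes D \<Longrightarrow> permutation p"
  using finite_D permutation_permutes by blast

lemma self_in_orbit: "p permutes D \<Longrightarrow> x \<in> orbit p x"
  by (rule permutation_self_in_orbit[OF permutation_D])

lemma matchingD:
  assumes "matching \<iota>"
  shows "\<iota> permutes D" "\<iota> (\<iota> x) = x" "x \<in> D \<Longrightarrow> \<iota> x \<noteq> x" "x \<in> D \<Longrightarrow> \<iota> x \<in> D"
    "x \<in> D \<Longrightarrow> L (\<iota> x) = L x - g x"
    "x \<in> D \<Longrightarrow> g (\<iota> x) = - g x" "x \<in> D \<Longrightarrow> L (\<theta> (\<iota> x)) = L x" "\<theta> \<circ> \<iota> permutes D"
proof -
  from assms show p: "\<iota> permutes D" and i: "\<iota> (\<iota> x) = x" and "x \<in> D \<Longrightarrow> \<iota> x \<noteq> x"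
    by (auto simp: matching_def fun_eq_iff)
  show D: "x \<in> D \<Longrightarrow> \<iota> x \<in> D" by (simp add: permutes_in_image[OF p])
  have L: "L (\<iota> y) = L (\<theta> y)" if "y \<in> D" for y using assms that by (auto simp: matching_def)
  then show L1: "x \<in> D \<Longrightarrow> L (\<iota> x) = L x - g x" by (simp add: L_\<theta>)
  show L2: "x \<in> D \<Longrightarrow> L (\<theta> (\<iota> x)) = L x" using L[of "\<iota> x"] D i by simp
  show "x \<in> D \<Longrightarrow> g (\<iota> x) = - g x" using L1 L2 L_\<theta>[of "\<iota> x"] by simp
  show "\<theta> \<circ> \<iota> permutes D" using p \<theta> by (rule permutes_compose)
qed

lemma orbit_face:
  assumes "matching \<iota>" "x \<in> D" "y \<in> orbit (\<theta> \<circ> \<iota>) x"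
  shows "y \<in> D" "L y = L x"
proof -
  from assms(3) have "y \<in> D \<and> L y = L x"
    by induct (use assms(2) matchingD[OF assms(1)] \<theta>_in in auto)
  then show "y \<in> D" "L y = L x" by auto
qed

text \<open>
  The heights \<open>L\<close> and \<open>L \<circ> \<theta>\<close> have the same sum, so \<open>g\<close> has sum \<open>0\<close>.
\<close>

lemma card_g_balanced: "card {x \<in> D. g x = 1} = card {x \<in> D. g x = -1}"
proof -
  have "(\<Sum>x\<in>D. L (\<theta> x)) = (\<Sum>x\<in>D. L x)"
    using sum.permute[OF \<theta>, of L] by (simp add: o_def)
  then have "(\<Sum>x\<in>D. g x) = 0" by (simp add: g_def sum_subtractf)
  moreover have "g x = (if g x = 1 then 1 else 0) - (if g x = -1 then 1 else 0)" if "x \<in> D" for x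
    using that by (cases rule: g_cases) auto
  then have "(\<Sum>x\<in>D. g x) =
      (\<Sum>x\<in>D. (if g x = 1 then 1 else 0) - (if g x = -1 then 1 else 0))"
    by (rule sum.cong[OF refl])
  ultimately have "int (card {x \<in> D. g x = 1}) = int (card {x \<in> D. g x = -1})"
    using finite_D by (simp add: sum_subtractf sum.If_cases Int_def)
  then show ?thesis by simp
qed

lemma mobile_exists:
  assumes "geodesic_map \<iota>"
  shows "\<exists>\<sigma>. corresponds \<iota> \<sigma>"
proof -
  let ?\<phi> = "\<theta> \<circ> \<iota>" and ?P = "\<lambda>y. g y = 1"
  have m: "matching \<iota>" using assms by (simp add: geodesic_map_def)
  note m' = matchingD[OF m]
  \<comment> \<open>The inverse of the mobile, as return maps run forwards along the faces.\<close>
  define t where "t x = (if x \<in> D \<and> g x = 1 then (SOME w. first_return ?\<phi> ?P x w)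
    else if x \<in> D \<and> g x = 0 then \<iota> x else x)" for x
  have ret: "first_return ?\<phi> ?P x (t x)" if x: "x \<in> D" "g x = 1" for x
  proof -
    obtain w where "first_return ?\<phi> ?P x w"
      using first_return_exists[of x ?\<phi> x ?P] x self_in_orbit[OF m'(8)] by metis
    then show ?thesis unfolding t_def using x by (auto intro: someI)
  qed
  have gt: "t x \<in> D \<and> g (t x) = g x" if "x \<in> D" for x
    using that
  proof (cases rule: g_cases)
    case 3
    with ret that have "g (t x) = 1" by (auto simp: first_return_def)
    moreover have "t x \<in> D"
      using orbit_face(1)[OF m that first_return_in_orbit[OF ret]] that 3 by simp
    ultimately show ?thesis using 3 by simp
  qed (use m'(4,6) that in \<open>auto simp: t_def\<close>)
  have "inj_on t D"
  proof (rule inj_onI)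
    fix x y assume xy: "x \<in> D" "y \<in> D" "t x = t y"
    then have g: "g x = g y" using gt by metis
    from xy(1) show "x = y"
    proof (cases rule: g_cases)
      case 1
      then show ?thesis using xy g by (simp add: t_def)
    next
      case 2
      then have "\<iota> x = \<iota> y" using xy g by (simp add: t_def)
      then show ?thesis using m'(2) by metis
    next
      case 3
      then show ?thesis
        using first_return_inj[OF permutes_inj[OF m'(8)], of ?P x y "t x"] ret[of x] ret[of y] xy g
        by auto
    qed
  qed
  moreover have "t ` D \<subseteq> D" using gt by auto
  ultimately have "bij_betw t D D"
    by (simp add: bij_betw_def endo_inj_surj finite_D)
  then have t: "t permutes D" by (rule bij_imp_permutes) (simp add: t_def)
  have tinv: "t (inv' t x) = x" "inv' t x \<in> D \<longleftrightarrow> x \<in> D" for x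
    using permutes_inverses[OF t] permutes_in_image[OF permutes_inv[OF t]] by auto
  have ginv: "g (inv' t x) = g x" if "x \<in> D" for x using gt tinv that by metis
  have "corresponds \<iota> (inv' t)"
    unfolding corresponds_def
  proof (intro conjI ballI impI)
    show "inv' t permutes D" by (rule permutes_inv[OF t])
    fix x assume x: "x \<in> D"
    show "inv' t x = x" if "g x = -1"
    proof -
      have "t x = x" using that by (simp add: t_def)
      then show ?thesis using tinv permutes_inj[OF t] by (metis injD)
    qed
    show "inv' t x = \<iota> x" if "g x = 0"
    proof -
      have "t (\<iota> x) = x" using that x m'(2,4,6) by (simp add: t_def)
      then show ?thesis using tinv permutes_inj[OF t] by (metis injD)
    qed
    assume g: "g x = 1"
    show "g (inv' t x) = 1" using ginv x g by simp
    show "first_return ?\<phi> ?P (inv' t x) x" using ret[of "inv' t x"] tinv x ginv g by simp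
  qed
  then show ?thesis by blast
qed

lemma corresponds_preserves:
  assumes m: "matching \<iota>" and c: "corresponds \<iota> \<sigma>" and "x \<in> D"
  shows "\<sigma> x \<in> D" "g (\<sigma> x) = g x" "L (\<sigma> x) = L x"
proof -
  have \<sigma>: "\<sigma> permutes D" using c by (simp add: corresponds_def)
  show D: "\<sigma> x \<in> D" using \<open>x \<in> D\<close> by (simp add: permutes_in_image[OF \<sigma>])
  have "g (\<sigma> x) = g x \<and> L (\<sigma> x) = L x"
    using \<open>x \<in> D\<close>
  proof (cases rule: g_cases)
    case 3
    then have "g (\<sigma> x) = 1" "x \<in> orbit (\<theta> \<circ> \<iota>) (\<sigma> x)"
      using c \<open>x \<in> D\<close> by (auto simp: corresponds_def dest: first_return_in_orbit)
    then show ?thesis using orbit_face(2)[OF m D] 3 by simp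
  qed (use c m \<open>x \<in> D\<close> matchingD[OF m] in \<open>auto simp: corresponds_def\<close>)
  then show "g (\<sigma> x) = g x" "L (\<sigma> x) = L x" by auto
qed

text \<open>
  Here \<open>\<psi>\<close> stands for the contour. A face walk from \<open>i\<close> that meets only half-edges with \<open>g \<le> 0\<close>
  moves at constant height \<open>L i\<close>. Each of its steps is a contour excursion that stays at or above that
  height, and \<open>\<iota> i\<close> is one unit lower, so the concatenated excursions never come back down to it.
\<close>

lemma face_path_to_contour_path:
  assumes m: "matching \<iota>" and i: "i \<in> D" "g i = 1" and \<psi>: "\<psi> (\<iota> i) = \<theta> (\<iota> i)"
    and ret: "\<And>w. w \<in> D \<Longrightarrow> g w \<le> 0 \<Longrightarrow> L w = L i \<Longrightarrow>
      first_return \<psi> (\<lambda>y. L y \<le> L w) w (\<theta> (\<iota> w))"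
    and path: "avoiding_path (\<theta> \<circ> \<iota>) (\<lambda>y. g y = 1) i w"
  shows "avoiding_path \<psi> (\<lambda>y. L y \<le> L (\<iota> i)) (\<iota> i) (\<theta> (\<iota> w)) \<and> w \<in> D \<and> L w = L i"
proof -
  note m' = matchingD[OF m]
  have Li: "L (\<iota> i) < L i" using m'(5) i by simp
  let ?Q = "\<lambda>y. L y \<le> L (\<iota> i)"
  from path show ?thesis
  proof (induct rule: avoiding_path_induct)
    case base
    have "\<not> ?Q (\<theta> (\<iota> i))" using m'(7) i Li by simp
    then have "avoiding_path \<psi> ?Q (\<iota> i) (\<theta> (\<iota> i))"
      using avoiding_path_step[OF avoiding_path_refl, of ?Q \<psi> "\<iota> i"] \<psi> by simp
    then show ?case using i by simp
  next
    case (step v)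
    define w where "w = \<theta> (\<iota> v)"
    have w: "g w \<noteq> 1" "w \<in> D" "L w = L i" and iw: "avoiding_path \<psi> ?Q (\<iota> i) w"
      using step m'(4,7) \<theta>_in by (auto simp: w_def)
    then have gw: "g w \<le> 0" using g_cases[OF w(2)] by force
    obtain z where z: "avoiding_path \<psi> (\<lambda>y. L y \<le> L w) w z" "\<psi> z = \<theta> (\<iota> w)"
      using ret[OF w(2) gw w(3)] unfolding first_return_def by blast
    have "avoiding_path \<psi> ?Q w z"
      using z(1) by (rule avoiding_path_mono) (use w Li in simp)
    with iw have "avoiding_path \<psi> ?Q (\<iota> i) z" by (rule avoiding_path_trans)
    then have "avoiding_path \<psi> ?Q (\<iota> i) (\<psi> z)"
      by (rule avoiding_path_step) (use z(2) m'(7)[OF w(2)] w(3) Li in simp)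
    with z(2) w show ?case by (simp add: w_def)
  qed
qed

text \<open>
  If \<open>g x = 0\<close>, the contour step and the face step agree. If \<open>g x = -1\<close>, the contour enters the face
  of \<open>\<iota> x\<close>, one unit higher, and follows it up to the next half-edge \<open>y\<close> with \<open>g y = 1\<close>; as
  \<open>\<sigma> y = \<iota> x\<close> it then jumps to \<open>\<theta> (\<iota> x)\<close>. Following the higher face is possible by the claim for
  greater heights, which calls for an induction from the top downwards.
\<close>

lemma descent_return:
  assumes geo: "geodesic_map \<iota>" and c: "corresponds \<iota> \<sigma>"
  shows "descent_return \<iota> \<sigma>"
proof -
  have m: "matching \<iota>" using geo by (simp add: geodesic_map_def)
  note m' = matchingD[OF m] and c' = corresponds_preserves[OF m c]
  have \<sigma>: "\<sigma> permutes D" using c by (simp add: corresponds_def)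
  have "first_return (\<theta> \<circ> \<sigma>) (\<lambda>y. L y \<le> L x) x (\<theta> (\<iota> x))" if "x \<in> D" "g x \<le> 0" for x
    using that
  proof (induct "nat (Max (L ` D) - L x)" arbitrary: x rule: less_induct)
    case less
    have "g x = 0 \<or> g x = -1" using g_cases[OF less(2)] less(3) by force
    then show ?case
    proof
      assume "g x = 0"
      then have "\<sigma> x = \<iota> x" using c less by (simp add: corresponds_def)
      then have "(\<theta> \<circ> \<sigma>) x = \<theta> (\<iota> x)" by simp
      then show ?thesis unfolding first_return_def
        using avoiding_path_refl[of _ _ x] m'(7)[OF less(2)] by fastforce
    next
      assume gx: "g x = -1"
      let ?i = "\<iota> x"
      have i: "?i \<in> D" "g ?i = 1" "\<iota> ?i = x" "L ?i = L x + 1"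
        using m' gx less(2) by auto
      have \<sigma>x: "(\<theta> \<circ> \<sigma>) (\<iota> ?i) = \<theta> (\<iota> ?i)"
        using c gx less(2) i by (simp add: corresponds_def)
      obtain y where y: "y \<in> D" "\<sigma> y = ?i"
        using i(1) permutes_image[OF \<sigma>] by (metis imageE)
      have gy: "g y = 1" using c'(2)[OF y(1)] y(2) i(2) by simp
      then have "first_return (\<theta> \<circ> \<iota>) (\<lambda>y. g y = 1) (\<sigma> y) y"
        using c y(1) unfolding corresponds_def by blast
      then obtain z where z: "avoiding_path (\<theta> \<circ> \<iota>) (\<lambda>y. g y = 1) ?i z" "(\<theta> \<circ> \<iota>) z = y"
        unfolding first_return_def y(2) by blast
      have "L w \<le> Max (L ` D)" if "w \<in> D" for w using that finite_D by simp
      then have "first_return (\<theta> \<circ> \<sigma>) (\<lambda>y. L y \<le> L w) w (\<theta> (\<iota> w))"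
        if "w \<in> D" "g w \<le> 0" "L w = L ?i" for w
        using less(1)[of w] that i(4) by force
      note face_path_to_contour_path[OF m i(1,2) \<sigma>x this z(1)]
      then have "avoiding_path (\<theta> \<circ> \<sigma>) (\<lambda>y. L y \<le> L x) x y"
        unfolding i(3) using z(2) unfolding comp_def by blast
      moreover have "(\<theta> \<circ> \<sigma>) y = \<theta> (\<iota> x)" using y by simp
      moreover have "L (\<theta> (\<iota> x)) \<le> L x" using m'(7)[OF less(2)] by simp
      ultimately show ?thesis unfolding first_return_def by blast
    qed
  qed
  then show ?thesis by (simp add: descent_return_def)
qed

text \<open>
  That the contour is one cycle: face steps with \<open>g \<le> 0\<close> stay on one contour orbit, so the face of
  height \<open>0\<close> lies on one orbit. In a higher face these steps lead to a half-edge with \<open>g = 1\<close>, where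
  the contour goes down, and thus every orbit reaches height \<open>0\<close>.
\<close>

lemma corresponds_mobile:
  assumes geo: "geodesic_map \<iota>" and c: "corresponds \<iota> \<sigma>"
  shows "mobile \<sigma>"
proof -
  have m: "matching \<iota>" using geo by (simp add: geodesic_map_def)
  note m' = matchingD[OF m] and c' = corresponds_preserves[OF m c]
  define \<psi> where "\<psi> = \<theta> \<circ> \<sigma>"
  define \<phi> where "\<phi> = \<theta> \<circ> \<iota>"
  have app: "\<psi> x = \<theta> (\<sigma> x)" "\<phi> x = \<theta> (\<iota> x)" for x by (simp_all add: \<psi>_def \<phi>_def)
  have \<sigma>: "\<sigma> permutes D" using c by (simp add: corresponds_def)
  have \<psi>: "\<psi> permutes D" unfolding \<psi>_def using \<sigma> \<theta> by (rule permutes_compose)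
  have face: "y \<in> D" "L y = L x" if "x \<in> D" "y \<in> orbit \<phi> x" for x y
    using orbit_face[OF m] that unfolding \<phi>_def by auto
  have geo': "x \<in> D \<Longrightarrow> y \<in> D \<Longrightarrow> L x = 0 \<Longrightarrow> L y = 0 \<Longrightarrow> y \<in> orbit \<phi> x"
    "x \<in> D \<Longrightarrow> L x > 0 \<Longrightarrow> \<exists>y\<in>orbit \<phi> x. g y = 1" for x y
    using geo unfolding geodesic_map_def \<phi>_def by blast+
  note orb = orbit_eq_iff[OF permutation_D[OF \<psi>], symmetric]
  have next_face: "orbit \<psi> (\<phi> x) = orbit \<psi> x" if "x \<in> D" "g x \<le> 0" for x
  proof -
    have "first_return \<psi> (\<lambda>y. L y \<le> L x) x (\<theta> (\<iota> x))"
      using descent_return[OF geo c] that unfolding descent_return_def \<psi>_def by blast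
    from first_return_in_orbit[OF this] show ?thesis using orb app by simp
  qed
  have same: "orbit \<psi> y = orbit \<psi> x" if "x \<in> D" "L x = 0" "y \<in> orbit \<phi> x" for x y
    using that(3)
  proof induct
    case base
    have "g x \<le> 0" using L_pos[of x] that g_nonpos[of x] by force
    then show ?case using next_face that by simp
  next
    case (step y)
    then have "y \<in> D" "L y = 0" using face[OF that(1)] that(2) by auto
    then have "g y \<le> 0" using L_pos[of y] g_nonpos[of y] by force
    with \<open>y \<in> D\<close> step next_face show ?case by simp
  qed
  have down: "\<exists>z\<in>D. L z = 0 \<and> orbit \<psi> z = orbit \<psi> x" if "x \<in> D" for x
    using that
  proof (induct "nat (L x)" arbitrary: x rule: less_induct)
    case less
    show ?case
    proof (cases "L x = 0")
      case False
      then have "L x > 0" using L_nonneg[OF less(2)] by simp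
      have *: "(\<exists>z\<in>D. g z = 1 \<and> L z = L x \<and> orbit \<psi> z = orbit \<psi> x) \<or> orbit \<psi> y = orbit \<psi> x"
        if "y \<in> orbit \<phi> x" for y
        using that
      proof induct
        case base
        show ?case using next_face[OF less(2) g_nonpos[OF less(2)]] less(2) by blast
      next
        case (step y)
        then have "y \<in> D" "L y = L x" using face[OF less(2)] by auto
        then show ?case using step(2) next_face[OF _ g_nonpos, of y] by metis
      qed
      obtain y where y: "y \<in> orbit \<phi> x" "g y = 1"
        using geo'(2) less(2) \<open>L x > 0\<close> by blast
      then have "\<exists>z\<in>D. g z = 1 \<and> L z = L x \<and> orbit \<psi> z = orbit \<psi> x"
        using * face[OF less(2)] by blast
      then obtain z where z: "z \<in> D" "g z = 1" "L z = L x" "orbit \<psi> z = orbit \<psi> x" by auto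
      have "L (\<psi> z) = L x - 1" "\<psi> z \<in> D"
        using z c' L_\<theta>[of "\<sigma> z"] \<theta>_in by (auto simp: app)
      moreover have "orbit \<psi> (\<psi> z) = orbit \<psi> z"
        by (rule permutation_orbit_step[OF permutation_D[OF \<psi>]])
      ultimately show ?thesis using less(1)[of "\<psi> z"] \<open>L x > 0\<close> z(4) by auto
    qed (use less in auto)
  qed
  have "y \<in> orbit \<psi> x" if xy: "x \<in> D" "y \<in> D" for x y
  proof -
    obtain a b where ab: "a \<in> D" "L a = 0" "orbit \<psi> a = orbit \<psi> x"
      "b \<in> D" "L b = 0" "orbit \<psi> b = orbit \<psi> y"
      using down xy by metis
    then have "b \<in> orbit \<phi> a" using geo'(1) by blast
    with same ab have "orbit \<psi> y = orbit \<psi> x" by metis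
    then show ?thesis using self_in_orbit[OF \<psi>, of y] by simp
  qed
  moreover have "\<sigma> x \<noteq> x \<and> \<sigma> (\<sigma> x) = x" if "x \<in> D" "g x = 0" for x
  proof -
    have "\<sigma> x = \<iota> x" "\<sigma> (\<iota> x) = \<iota> (\<iota> x)"
      using c that m'(4)[of x] m'(6)[of x] by (auto simp: corresponds_def)
    then show ?thesis using m' that by simp
  qed
  ultimately show ?thesis
    using \<sigma> c c' unfolding mobile_def corresponds_def \<psi>_def by blast
qed

lemma mobileD:
  assumes "mobile \<sigma>"
  shows "\<sigma> permutes D" "x \<in> D \<Longrightarrow> \<sigma> x \<in> D" "x \<in> D \<Longrightarrow> L (\<sigma> x) = L x" "x \<in> D \<Longrightarrow> g (\<sigma> x) = g x"
    "x \<in> D \<Longrightarrow> g x = -1 \<Longrightarrow> \<sigma> x = x" "x \<in> D \<Longrightarrow> g x = 0 \<Longrightarrow> \<sigma> x \<noteq> x"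
    "x \<in> D \<Longrightarrow> g x = 0 \<Longrightarrow> \<sigma> (\<sigma> x) = x"
    "x \<in> D \<Longrightarrow> y \<in> D \<Longrightarrow> y \<in> orbit (\<theta> \<circ> \<sigma>) x"
    "x \<in> D \<Longrightarrow> L (\<theta> (\<sigma> x)) = L x - g x"
proof -
  have \<sigma>: "\<sigma> permutes D" and all: "\<And>x. x \<in> D \<Longrightarrow> L (\<sigma> x) = L x \<and> g (\<sigma> x) = g x \<and>
      (g x = -1 \<longrightarrow> \<sigma> x = x) \<and> (g x = 0 \<longrightarrow> \<sigma> x \<noteq> x \<and> \<sigma> (\<sigma> x) = x)"
    using assms unfolding mobile_def by blast+
  show "\<sigma> permutes D" "x \<in> D \<Longrightarrow> \<sigma> x \<in> D" "x \<in> D \<Longrightarrow> L (\<sigma> x) = L x" "x \<in> D \<Longrightarrow> g (\<sigma> x) = g x"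
    "x \<in> D \<Longrightarrow> g x = -1 \<Longrightarrow> \<sigma> x = x" "x \<in> D \<Longrightarrow> g x = 0 \<Longrightarrow> \<sigma> x \<noteq> x"
    "x \<in> D \<Longrightarrow> g x = 0 \<Longrightarrow> \<sigma> (\<sigma> x) = x"
    using \<sigma> all[of x] permutes_in_image[OF \<sigma>] by blast+
  show "x \<in> D \<Longrightarrow> L (\<theta> (\<sigma> x)) = L x - g x" using all[of x] by (simp add: L_\<theta>)
  show "x \<in> D \<Longrightarrow> y \<in> D \<Longrightarrow> y \<in> orbit (\<theta> \<circ> \<sigma>) x" using assms unfolding mobile_def by blast
qed

text \<open>
  The contour loses at most one unit of height at each step, so it comes back to the height of \<open>x\<close>
  by a descent from \<open>L x + 1\<close>; the half-edge \<open>c\<close> is the image under \<open>\<sigma>\<close> of that descent.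
\<close>

lemma ascent_closing:
  assumes mob: "mobile \<sigma>" and x: "x \<in> D" "g x = -1"
  shows "\<exists>c\<in>D. g c = 1 \<and> L c = L x + 1 \<and> first_return (\<theta> \<circ> \<sigma>) (\<lambda>y. L y \<le> L x) x (\<theta> c)"
proof -
  note M = mobileD[OF mob]
  define \<psi> where "\<psi> = \<theta> \<circ> \<sigma>"
  have \<psi>: "\<psi> permutes D" unfolding \<psi>_def using M(1) \<theta> by (rule permutes_compose)
  have app: "\<psi> y = \<theta> (\<sigma> y)" for y by (simp add: \<psi>_def)
  let ?P = "\<lambda>y. L y \<le> L x"
  obtain y where "first_return \<psi> ?P x y"
    using first_return_exists[OF self_in_orbit[OF \<psi>], of ?P x] by blast
  then obtain z where y: "?P y" and z: "avoiding_path \<psi> ?P x z" "\<psi> z = y"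
    unfolding first_return_def by blast
  have "z \<in> D"
    using avoiding_path_in_orbit[OF z(1)] x permutes_orbit_subset[OF \<psi> x(1)] by auto
  have "L (\<psi> x) = L x + 1" using M(9)[OF x(1)] x by (simp add: app)
  then have "z \<noteq> x" using z y by auto
  then have "L z > L x" using avoiding_path_end[OF z(1)] by simp
  moreover have "L (\<psi> z) = L z - g z" using M(9)[OF \<open>z \<in> D\<close>] by (simp add: app)
  ultimately have "g z = 1 \<and> L z = L x + 1" using g_cases[OF \<open>z \<in> D\<close>] y z(2) by fastforce
  then have "g (\<sigma> z) = 1" "L (\<sigma> z) = L x + 1" "\<sigma> z \<in> D" using M \<open>z \<in> D\<close> by auto
  moreover have "first_return \<psi> ?P x (\<theta> (\<sigma> z))"
    using y z unfolding first_return_def app by blast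
  ultimately show ?thesis unfolding \<psi>_def by blast
qed

text \<open>
  The bracket matching of ascents with descents. It is injective since a first return
  determines its start, and bijective because there are as many descents as ascents.
\<close>

lemma map_exists:
  assumes mob: "mobile \<sigma>"
  shows "\<exists>\<iota>. matching \<iota> \<and> descent_return \<iota> \<sigma>"
proof -
  note M = mobileD[OF mob]
  define \<psi> where "\<psi> = \<theta> \<circ> \<sigma>"
  have \<psi>: "\<psi> permutes D" unfolding \<psi>_def using M(1) \<theta> by (rule permutes_compose)
  let ?N = "{x \<in> D. g x = -1}" and ?P = "{x \<in> D. g x = 1}"
  obtain c where c: "\<And>x. x \<in> D \<Longrightarrow> g x = -1 \<Longrightarrow> c x \<in> D \<and> g (c x) = 1 \<and> L (c x) = L x + 1 \<and>
      first_return \<psi> (\<lambda>y. L y \<le> L x) x (\<theta> (c x))"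
    using ascent_closing[OF mob] unfolding \<psi>_def by metis
  have "inj_on c ?N"
  proof (rule inj_onI)
    fix x y assume xy: "x \<in> ?N" "y \<in> ?N" "c x = c y"
    then have "L x = L y" using c[of x] c[of y] by auto
    with xy c[of x] c[of y] show "x = y"
      using first_return_inj[OF permutes_inj[OF \<psi>], of "\<lambda>z. L z \<le> L x" x y "\<theta> (c x)"] by auto
  qed
  moreover have "c ` ?N \<subseteq> ?P" using c by auto
  ultimately have bij: "bij_betw c ?N ?P"
    using finite_D card_g_balanced
    by (simp add: bij_betw_def card_image card_subset_eq)
  define d where "d = inv_into ?N c"
  have dc: "d (c x) = x" if "x \<in> D" "g x = -1" for x
    using bij_betw_inv_into_left[OF bij] that by (simp add: d_def)
  have cd: "d x \<in> D \<and> g (d x) = -1 \<and> c (d x) = x" if "x \<in> D" "g x = 1" for x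
    using bij_betw_inv_into_right[OF bij] bij_betwE[OF bij_betw_inv_into[OF bij]] that
    by (auto simp: d_def)
  define \<iota> where "\<iota> x = (if x \<notin> D then x else if g x = -1 then c x else
     if g x = 0 then \<sigma> x else d x)" for x
  have inv: "\<iota> x \<in> D \<and> \<iota> (\<iota> x) = x \<and> \<iota> x \<noteq> x \<and> L (\<iota> x) = L (\<theta> x)" if "x \<in> D" for x
    using that
  proof (cases rule: g_cases)
    case 1
    have C: "c x \<in> D" "g (c x) = 1" "L (c x) = L x + 1" using c[OF that 1] by auto
    have "\<iota> x = c x" "\<iota> (c x) = d (c x)" using that 1 C by (simp_all add: \<iota>_def)
    with C 1 dc[OF that 1] that show ?thesis by (auto simp: L_\<theta>)
  next
    case 2
    have "\<iota> x = \<sigma> x" "\<iota> (\<sigma> x) = \<sigma> (\<sigma> x)" using that 2 M(2,4) by (simp_all add: \<iota>_def)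
    with M(2,3,6,7)[OF that] 2 show ?thesis by (simp add: L_\<theta>)
  next
    case 3
    have C: "d x \<in> D" "g (d x) = -1" "c (d x) = x" using cd[OF that 3] by auto
    have "\<iota> x = d x" "\<iota> (d x) = c (d x)" using that 3 C by (simp_all add: \<iota>_def)
    moreover have "L x = L (d x) + 1" using c[OF C(1,2)] C(3) by simp
    ultimately show ?thesis using C 3 by (auto simp: L_\<theta>)
  qed
  have out: "\<iota> x = x" if "x \<notin> D" for x using that by (simp add: \<iota>_def)
  have ii: "\<iota> \<circ> \<iota> = id"
  proof
    show "(\<iota> \<circ> \<iota>) x = id x" for x by (cases "x \<in> D") (simp_all add: inv out)
  qed
  have "bij_betw \<iota> D D"
    by (rule bij_betw_byWitness[of D \<iota>]) (use inv in blast)+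
  then have "\<iota> permutes D" by (rule bij_imp_permutes) (rule out)
  with inv ii have "matching \<iota>" unfolding matching_def by blast
  moreover have "first_return \<psi> (\<lambda>y. L y \<le> L x) x (\<theta> (\<iota> x))" if "x \<in> D" "g x \<le> 0" for x
  proof -
    have "g x = -1 \<or> g x = 0" using g_cases[OF that(1)] that(2) by force
    then show ?thesis
    proof
      assume "g x = -1"
      then show ?thesis using c[OF that(1)] that(1) by (simp add: \<iota>_def)
    next
      assume gx: "g x = 0"
      then have "\<theta> (\<iota> x) = \<psi> x" using that(1) by (simp add: \<iota>_def \<psi>_def)
      moreover have "L (\<psi> x) \<le> L x" using M(9)[OF that(1)] gx by (simp add: \<psi>_def)
      ultimately show ?thesis unfolding first_return_def using avoiding_path_refl by metis
    qed
  qed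
  ultimately show ?thesis unfolding descent_return_def \<psi>_def by blast
qed

lemma descent_return_unique:
  assumes m: "matching \<iota>" "matching \<iota>'" and "descent_return \<iota> \<sigma>" "descent_return \<iota>' \<sigma>"
  shows "\<iota> = \<iota>'"
proof -
  note m' = matchingD[OF m(1)] and m'' = matchingD[OF m(2)]
  have low: "\<iota> x = \<iota>' x" if "x \<in> D" "g x \<le> 0" for x
  proof -
    have "\<theta> (\<iota> x) = \<theta> (\<iota>' x)"
      using assms(3,4) that first_return_unique unfolding descent_return_def by metis
    then show ?thesis using permutes_inj[OF \<theta>] by (metis injD)
  qed
  have "\<iota> x = \<iota>' x" for x
  proof (cases "x \<in> D")
    case True
    show ?thesis
    proof (cases "g x = 1")
      case gx: True
      have "\<iota>' (\<iota> x) = \<iota> (\<iota> x)" using low[of "\<iota> x"] m' True gx by simp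
      then show ?thesis using m'(2) m''(2) by metis
    next
      case False
      then show ?thesis using low True g_nonpos by blast
    qed
  next
    case False
    then show ?thesis using permutes_not_in m'(1) m''(1) by metis
  qed
  then show ?thesis by auto
qed

lemma corresponds_unique:
  assumes m: "matching \<iota>" and "corresponds \<iota> \<sigma>" "corresponds \<iota> \<sigma>'"
  shows "\<sigma> = \<sigma>'"
proof
  fix x
  have inj: "inj (\<theta> \<circ> \<iota>)" using matchingD(8)[OF m] by (rule permutes_inj)
  show "\<sigma> x = \<sigma>' x"
  proof (cases "x \<in> D")
    case True
    then show ?thesis
    proof (cases rule: g_cases)
      case 3
      with True show ?thesis using assms(2,3) unfolding corresponds_def
        by (metis (mono_tags, lifting) first_return_inj[OF inj, of "\<lambda>y. g y = 1"])
    qed (use assms(2,3) True in \<open>auto simp: corresponds_def\<close>)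
  next
    case False
    then show ?thesis using assms(2,3) permutes_not_in unfolding corresponds_def by metis
  qed
qed

text \<open>
  The returns of the contour to a fixed height are face steps. At height \<open>0\<close> this makes the face a
  return map of the single contour cycle. A face of positive height without \<open>g = 1\<close> would keep the
  contour at or above its height forever, although the contour visits height \<open>0\<close>.
\<close>

lemma descent_return_geodesic:
  assumes mob: "mobile \<sigma>" and m: "matching \<iota>" and ret: "descent_return \<iota> \<sigma>"
  shows "geodesic_map \<iota>"
proof -
  note M = mobileD[OF mob] and m' = matchingD[OF m]
  define \<psi> where "\<psi> = \<theta> \<circ> \<sigma>"
  define \<phi> where "\<phi> = \<theta> \<circ> \<iota>"
  have \<phi>: "\<phi> permutes D" unfolding \<phi>_def by (rule m'(8))
  have app: "\<phi> x = \<theta> (\<iota> x)" for x by (simp add: \<phi>_def)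
  have ret': "first_return \<psi> (\<lambda>y. L y \<le> L x) x (\<phi> x)" if "x \<in> D" "g x \<le> 0" for x
    using ret that unfolding descent_return_def \<psi>_def app by blast
  have face: "y \<in> D" "L y = L x" if "x \<in> D" "y \<in> orbit \<phi> x" for x y
    using orbit_face[OF m] that unfolding \<phi>_def by auto
  have one: "y \<in> orbit \<psi> x" if "x \<in> D" "y \<in> D" for x y
    using M(8) that unfolding \<psi>_def by blast
  have "\<exists>y\<in>orbit \<phi> x. g y = 1" if x: "x \<in> D" "L x > 0" for x
  proof (rule ccontr)
    assume no: "\<not> ?thesis"
    obtain r where r: "r \<in> D" "L r = 0" using L_zero by auto
    have "\<exists>v\<in>orbit \<phi> x. avoiding_path \<psi> (\<lambda>y. L y \<le> L x) v r"
    proof (rule orbit_covered_by_returns)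
      show "x \<in> orbit \<phi> x" by (rule self_in_orbit[OF \<phi>])
      show "r \<in> orbit \<psi> x" using one x r by blast
      fix v assume v: "v \<in> orbit \<phi> x"
      then have "v \<in> D" "L v = L x" "g v \<le> 0" using face[OF x(1) v] g_nonpos no by auto
      with ret'[of v] v show "first_return \<psi> (\<lambda>y. L y \<le> L x) v (\<phi> v) \<and> \<phi> v \<in> orbit \<phi> x"
        by (simp add: orbit.step)
    qed
    then show False using avoiding_path_end face[OF x(1)] x r by fastforce
  qed
  moreover have "y \<in> orbit \<phi> x" if xy: "x \<in> D" "y \<in> D" "L x = 0" "L y = 0" for x y
  proof -
    have "orbit \<phi> x = {y \<in> orbit \<psi> x. y \<in> D \<and> L y = 0}"
    proof (rule orbit_return_map)
      fix v assume v: "v \<in> D \<and> L v = 0"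
      then have "g v \<le> 0" using L_pos[of v] g_nonpos[of v] by force
      with ret' v have "first_return \<psi> (\<lambda>y. L y \<le> L v) v (\<phi> v)" by blast
      moreover have "\<phi> v \<in> D \<and> L (\<phi> v) = 0" using face[of v "\<phi> v"] v orbit.base by force
      ultimately show "first_return \<psi> (\<lambda>y. y \<in> D \<and> L y = 0) v (\<phi> v)"
        by (elim first_return_mono) (use v in auto)
    qed (use xy self_in_orbit[OF \<phi>] in auto)
    with xy one show ?thesis by blast
  qed
  ultimately show ?thesis using m unfolding geodesic_map_def \<phi>_def by blast
qed

text \<open>
  For \<open>g x = 1\<close>, both \<open>x\<close> and the next such half-edge \<open>y\<close> on the face walk from \<open>\<sigma> x\<close> are the last
  point of the contour excursion that starts at \<open>\<iota> (\<sigma> x)\<close>.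
\<close>

lemma descent_return_corresponds:
  assumes mob: "mobile \<sigma>" and m: "matching \<iota>" and ret: "descent_return \<iota> \<sigma>"
  shows "corresponds \<iota> \<sigma>"
proof -
  note M = mobileD[OF mob] and m' = matchingD[OF m]
  define \<psi> where "\<psi> = \<theta> \<circ> \<sigma>"
  define \<phi> where "\<phi> = \<theta> \<circ> \<iota>"
  have \<phi>: "\<phi> permutes D" unfolding \<phi>_def by (rule m'(8))
  have app: "\<phi> x = \<theta> (\<iota> x)" "\<psi> x = \<theta> (\<sigma> x)" for x by (simp_all add: \<phi>_def \<psi>_def)
  have ret': "first_return \<psi> (\<lambda>y. L y \<le> L x) x (\<theta> (\<iota> x))" if "x \<in> D" "g x \<le> 0" for x
    using ret that unfolding descent_return_def \<psi>_def by blast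
  have flat: "\<sigma> x = \<iota> x" if "x \<in> D" "g x = 0" for x
  proof -
    have "first_return \<psi> (\<lambda>y. L y \<le> L x) x (\<psi> x)"
      unfolding first_return_def using M(9)[OF that(1)] that(2) avoiding_path_refl
      by (metis app(2) diff_zero order_refl)
    then have "\<psi> x = \<theta> (\<iota> x)" using ret'[OF that(1)] that(2) first_return_unique by fastforce
    then show ?thesis using permutes_inj[OF \<theta>] by (simp add: app injD)
  qed
  have rise: "first_return \<phi> (\<lambda>y. g y = 1) (\<sigma> x) x" if x: "x \<in> D" "g x = 1" for x
  proof -
    define i where "i = \<sigma> x"
    define j where "j = \<iota> i"
    have i: "i \<in> D" "g i = 1" using M x by (auto simp: i_def)
    have j: "j \<in> D" "g j = -1" "\<iota> j = i" "L j = L i - 1" using m' i by (auto simp: j_def)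
    have start: "\<psi> (\<iota> i) = \<theta> (\<iota> i)" using M(5) j by (simp add: app j_def)
    obtain z where z: "avoiding_path \<psi> (\<lambda>y. L y \<le> L j) j z" "\<psi> z = \<theta> i" "L (\<theta> i) \<le> L j"
      using ret'[OF j(1)] j unfolding first_return_def by auto
    have "z = x" using z(2) permutes_inj[OF \<theta>] permutes_inj[OF M(1)]
      by (auto simp: app i_def dest!: injD)
    obtain y where y: "first_return \<phi> (\<lambda>y. g y = 1) i y"
      using first_return_exists[OF self_in_orbit[OF \<phi>], of "\<lambda>y. g y = 1" i] i by blast
    then obtain v where v: "avoiding_path \<phi> (\<lambda>y. g y = 1) i v" "\<phi> v = y" "g y = 1"
      unfolding first_return_def by blast
    have "avoiding_path \<psi> (\<lambda>y. L y \<le> L (\<iota> i)) (\<iota> i) (\<theta> (\<iota> v)) \<and> v \<in> D \<and> L v = L i"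
    proof (rule face_path_to_contour_path[where \<psi> = \<psi>, OF m i start])
      show "avoiding_path (\<theta> \<circ> \<iota>) (\<lambda>y. g y = 1) i v" using v(1) unfolding \<phi>_def .
    qed (rule ret')
    then have yp: "avoiding_path \<psi> (\<lambda>y. L y \<le> L j) j y" "v \<in> D" "L v = L i"
      using v(2) by (auto simp: app j_def)
    have "y \<in> D" "L y = L i" using yp m' v(2) \<theta>_in by (auto simp: app)
    then have "L (\<psi> y) \<le> L j" using M(9)[of y] v(3) j(4) by (simp add: app)
    then have "y = z" using avoiding_path_last_unique[OF yp(1) _ z(1)] z(2,3) by simp
    with y \<open>z = x\<close> show ?thesis by (simp add: i_def)
  qed
  show ?thesis unfolding corresponds_def
    using M(1,4,5) flat rise unfolding \<phi>_def by simp
qed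

lemma geodesic_mobile_bij:
  obtains f where "bij_betw f {\<iota>. geodesic_map \<iota>} {\<sigma>. mobile \<sigma>}"
    and "\<And>\<iota>. geodesic_map \<iota> \<Longrightarrow> corresponds \<iota> (f \<iota>)"
proof -
  obtain f where f: "\<And>\<iota>. geodesic_map \<iota> \<Longrightarrow> corresponds \<iota> (f \<iota>)"
    using mobile_exists by metis
  have m: "geodesic_map \<iota> \<Longrightarrow> matching \<iota>" for \<iota> by (simp add: geodesic_map_def)
  have "bij_betw f {\<iota>. geodesic_map \<iota>} {\<sigma>. mobile \<sigma>}"
    unfolding bij_betw_def
  proof (intro conjI subset_antisym subsetI)
    show "inj_on f {\<iota>. geodesic_map \<iota>}"
      by (rule inj_onI)
        (metis descent_return descent_return_unique f m mem_Collect_eq)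
    show "\<sigma> \<in> {\<sigma>. mobile \<sigma>}" if "\<sigma> \<in> f ` {\<iota>. geodesic_map \<iota>}" for \<sigma>
      using that f corresponds_mobile by auto
    fix \<sigma> assume "\<sigma> \<in> {\<sigma>. mobile \<sigma>}"
    then have mob: "mobile \<sigma>" by simp
    then obtain \<iota> where \<iota>: "matching \<iota>" "descent_return \<iota> \<sigma>" using map_exists by blast
    then have geo: "geodesic_map \<iota>" using descent_return_geodesic mob by blast
    have "f \<iota> = \<sigma>"
      using corresponds_unique[OF \<iota>(1)] f[OF geo] descent_return_corresponds[OF mob \<iota>] by blast
    with geo show "\<sigma> \<in> f ` {\<iota>. geodesic_map \<iota>}" by blast
  qed
  with f that show thesis by blast
qed

text \<open>
  Count the orbits of \<open>\<sigma>\<close> by the value of \<open>g\<close>: fixed points for \<open>-1\<close>, transpositions for \<open>0\<close>, and for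
  \<open>1\<close> one cycle in each face of positive height. Since the values \<open>1\<close> and \<open>-1\<close> are equally frequent,
  the first two kinds are as many as the edges of the map.
\<close>

lemma card_orbits_corresponds:
  assumes geo: "geodesic_map \<iota>" and c: "corresponds \<iota> \<sigma>"
  shows "2 * card (orbit \<sigma> ` D) + 2 = 2 * card (orbit (\<theta> \<circ> \<iota>) ` D) + card D"
proof -
  have m: "matching \<iota>" using geo by (simp add: geodesic_map_def)
  note m' = matchingD[OF m] and c' = corresponds_preserves[OF m c]
  define \<phi> where "\<phi> = \<theta> \<circ> \<iota>"
  have \<phi>: "\<phi> permutes D" unfolding \<phi>_def by (rule m'(8))
  have \<sigma>: "\<sigma> permutes D" using c by (simp add: corresponds_def)
  note self = self_in_orbit[OF \<sigma>] self_in_orbit[OF \<phi>]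
  have face: "y \<in> D" "L y = L x" if "x \<in> D" "y \<in> orbit \<phi> x" for x y
    using orbit_face[OF m] that unfolding \<phi>_def by auto
  define A where "A a = {x \<in> D. g x = a}" for a
  have orbA: "orbit \<sigma> x \<subseteq> A a" if "x \<in> A a" for x a
  proof
    fix y assume "y \<in> orbit \<sigma> x"
    then show "y \<in> A a" by induct (use c' that in \<open>auto simp: A_def\<close>)
  qed
  have fin: "finite (A a)" for a using finite_D by (simp add: A_def)
  have D: "D = A (-1) \<union> A 0 \<union> A 1" using g_cases unfolding A_def by blast
  have "A a \<inter> A b = {}" if "a \<noteq> b" for a b using that by (auto simp: A_def)
  then have disj: "orbit \<sigma> ` A a \<inter> orbit \<sigma> ` A b = {}" if "a \<noteq> b" for a b
    using that orbA self by blast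
  have cardD: "card D = card (A (-1)) + card (A 0) + card (A 1)"
    unfolding D by (subst card_Un_disjoint | use fin in \<open>auto simp: A_def\<close>)+
  have "orbit \<sigma> ` D = orbit \<sigma> ` A (-1) \<union> orbit \<sigma> ` A 0 \<union> orbit \<sigma> ` A 1"
    by (subst D) (simp add: image_Un)
  moreover have "(orbit \<sigma> ` A (-1) \<union> orbit \<sigma> ` A 0) \<inter> orbit \<sigma> ` A 1 = {}"
    using disj[of "-1" 1] disj[of 0 1] by auto
  ultimately have card\<sigma>: "card (orbit \<sigma> ` D) =
      card (orbit \<sigma> ` A (-1)) + card (orbit \<sigma> ` A 0) + card (orbit \<sigma> ` A 1)"
    using disj[of "-1" 0] by (simp add: card_Un_disjoint fin)
  have "orbit \<sigma> x = {x}" if "x \<in> A (-1)" for x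
    using c that by (simp add: orbit_eq_singleton_iff corresponds_def A_def)
  then have cm: "card (orbit \<sigma> ` A (-1)) = card (A (-1))"
    by (intro card_image inj_onI) auto
  have "\<sigma> x \<in> A 0 \<and> \<sigma> x \<noteq> x \<and> \<sigma> (\<sigma> x) = x" if "x \<in> A 0" for x
  proof -
    have "\<sigma> x = \<iota> x" "\<sigma> (\<iota> x) = \<iota> (\<iota> x)"
      using c that m'(4)[of x] m'(6)[of x] by (auto simp: corresponds_def A_def)
    then show ?thesis using m' that by (simp add: A_def)
  qed
  then have c0: "2 * card (orbit \<sigma> ` A 0) = card (A 0)"
    by (rule card_orbits_involution[OF fin])
  have "orbit \<sigma> x = {y \<in> orbit \<phi> x. y \<in> A 1}" if "x \<in> A 1" for x
  proof -
    have "orbit (inv' \<sigma>) x = {y \<in> orbit \<phi> x. y \<in> A 1}"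
    proof (rule orbit_return_map)
      show "x \<in> orbit (inv' \<sigma>) x" by (rule self_in_orbit[OF permutes_inv[OF \<sigma>]])
      fix y assume y: "y \<in> A 1"
      define x where "x = inv' \<sigma> y"
      have yx: "y = \<sigma> x" "x \<in> D" using y permutes_inverses[OF \<sigma>]
          permutes_in_image[OF permutes_inv[OF \<sigma>]] by (auto simp: x_def A_def)
      then have x: "x \<in> A 1" using y c'(2) by (simp add: A_def)
      then have "first_return \<phi> (\<lambda>y. g y = 1) (\<sigma> x) x"
        using c unfolding corresponds_def \<phi>_def A_def by blast
      then have "first_return \<phi> (\<lambda>y. y \<in> A 1) (\<sigma> x) x"
        by (rule first_return_mono) (use x in \<open>auto simp: A_def\<close>)
      then show "first_return \<phi> (\<lambda>y. y \<in> A 1) y (inv' \<sigma> y)" using yx x_def by metis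
    qed (rule that)
    then show ?thesis using orbit_inv_eq[OF permutation_D[OF \<sigma>], of x] by simp
  qed
  then have "orbit \<sigma> x = orbit \<sigma> y \<longleftrightarrow> orbit \<phi> x = orbit \<phi> y"
    if "x \<in> A 1" "y \<in> A 1" for x y
    using that orbit_eq_iff[OF permutation_D[OF \<sigma>], of x y]
      orbit_eq_iff[OF permutation_D[OF \<phi>], of x y] by auto
  then have c1: "card (orbit \<sigma> ` A 1) = card (orbit \<phi> ` A 1)"
    by (rule card_image_eq_iff)
  obtain r where r: "r \<in> D" "L r = 0" using L_zero by auto
  have low: "orbit \<phi> x = orbit \<phi> r" if "x \<in> D" "L x = 0" for x
    using geo that r orbit_eq_iff[OF permutation_D[OF \<phi>], of x r]
    unfolding geodesic_map_def \<phi>_def by blast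
  have high: "\<exists>y\<in>A 1. orbit \<phi> x = orbit \<phi> y" if x: "x \<in> D" "L x \<noteq> 0" for x
  proof -
    have "L x > 0" using L_nonneg[OF x(1)] x(2) by simp
    then obtain y where "y \<in> orbit \<phi> x" "g y = 1"
      using geo x unfolding geodesic_map_def \<phi>_def by blast
    then show ?thesis using face(1)[OF x(1)] orbit_eq_iff[OF permutation_D[OF \<phi>], of x y]
      by (auto simp: A_def)
  qed
  have "orbit \<phi> ` D = insert (orbit \<phi> r) (orbit \<phi> ` A 1)"
  proof (intro subset_antisym subsetI)
    fix C assume "C \<in> orbit \<phi> ` D"
    then obtain x where "x \<in> D" "C = orbit \<phi> x" by blast
    with low[of x] high[of x] show "C \<in> insert (orbit \<phi> r) (orbit \<phi> ` A 1)" by blast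
  qed (use r D in blast)
  moreover have "orbit \<phi> r \<notin> orbit \<phi> ` A 1"
  proof
    assume "orbit \<phi> r \<in> orbit \<phi> ` A 1"
    then obtain y where "y \<in> A 1" "orbit \<phi> r = orbit \<phi> y" by blast
    then have "y \<in> D" "g y = 1" "y \<in> orbit \<phi> r" using self(2)[of y] unfolding A_def by auto
    then show False using L_pos face(2)[OF r(1)] r(2) by fastforce
  qed
  ultimately have "card (orbit \<phi> ` D) = Suc (card (orbit \<phi> ` A 1))" using fin by simp
  then show ?thesis
    using cardD card\<sigma> cm c0 c1 card_g_balanced unfolding \<phi>_def A_def by simp
qed

end

section \<open>Potentials on a plane tree\<close>

lemma permutes_orbit_image:
  assumes "p permutes D" "finite D" "x \<in> D"
  shows "p ` orbit p x = orbit p x" "inj_on p (orbit p x)" "finite (orbit p x)"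
proof -
  show fin: "finite (orbit p x)"
    using permutes_orbit_subset[OF assms(1,3)] assms(2) by (rule finite_subset)
  show inj: "inj_on p (orbit p x)" using permutes_inj[OF assms(1)] by (rule inj_on_subset) simp
  show "p ` orbit p x = orbit p x"
    by (rule endo_inj_surj[OF fin _ inj]) (auto intro: orbit.step)
qed

lemma mod_eq_in_range:
  fixes a b N :: int
  assumes "a mod N = b mod N" "a \<in> {0..<N}" "b \<in> {0..<N}"
  shows "a = b"
  using assms by (metis atLeastLessThan_iff mod_pos_pos_trivial)

lemma card_orbit_invariant_functions:
  assumes D: "finite D" and \<sigma>: "\<sigma> permutes D"
  shows "N ^ card (orbit \<sigma> ` D) \<le> card {f \<in> D \<rightarrow>\<^sub>E {0..<int N}. \<forall>x\<in>D. f (\<sigma> x) = f x}"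
proof -
  let ?A = "{f \<in> D \<rightarrow>\<^sub>E {0..<int N}. \<forall>x\<in>D. f (\<sigma> x) = f x}"
  let ?S = "orbit \<sigma> ` D \<rightarrow>\<^sub>E {0..<int N}"
  let ?E = "\<lambda>F. \<lambda>x\<in>D. F (orbit \<sigma> x)"
  have perm: "permutation \<sigma>" using \<sigma> D permutation_permutes by blast
  have "inj_on ?E ?S"
  proof (rule inj_onI)
    fix F G assume F: "F \<in> ?S" "G \<in> ?S" and eq: "?E F = ?E G"
    have "F (orbit \<sigma> x) = G (orbit \<sigma> x)" if "x \<in> D" for x
      using fun_cong[OF eq, of x] that by simp
    with F show "F = G" by (intro PiE_ext) auto
  qed
  moreover have "?E ` ?S \<subseteq> ?A"
  proof
    fix f assume "f \<in> ?E ` ?S"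
    then obtain F where F: "F \<in> ?S" "f = ?E F" by blast
    have "f \<in> D \<rightarrow>\<^sub>E {0..<int N}" unfolding F(2) using F(1) by (intro restrict_PiE_iff[THEN iffD2]) blast
    moreover have "f (\<sigma> x) = f x" if "x \<in> D" for x
      using that permutes_in_image[OF \<sigma>] permutation_orbit_step[OF perm] by (simp add: F(2))
    ultimately show "f \<in> ?A" by blast
  qed
  moreover have "finite ?A"
    by (rule finite_subset[OF _ finite_PiE[OF D, of "\<lambda>_. {0..<int N}"]]) auto
  ultimately have "card ?S \<le> card ?A" by (rule card_inj_on_le)
  moreover have "card ?S = N ^ card (orbit \<sigma> ` D)"
    using D by (simp add: card_PiE)
  ultimately show ?thesis by simp
qed

text \<open>
  The values at one representative of each orbit are determined by the others.
\<close>

lemma card_orbit_balanced_functions: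
  assumes D: "finite D" and \<theta>: "\<theta> permutes D"
  shows "card {h \<in> D \<rightarrow>\<^sub>E {0..<int N}. \<forall>x\<in>D. (\<Sum>y\<in>orbit \<theta> x. h y) mod int N = 0}
    \<le> N ^ (card D - card (orbit \<theta> ` D))"
proof -
  let ?B = "{h \<in> D \<rightarrow>\<^sub>E {0..<int N}. \<forall>x\<in>D. (\<Sum>y\<in>orbit \<theta> x. h y) mod int N = 0}"
  have perm: "permutation \<theta>" using \<theta> D permutation_permutes by blast
  define rep where "rep C = (SOME x. x \<in> C)" for C :: "'a set"
  have rep: "rep C \<in> C" if "C \<in> orbit \<theta> ` D" for C
    using that orbit_nonempty unfolding rep_def by (metis (no_types) ex_in_conv imageE someI)
  define R where "R = rep ` orbit \<theta> ` D"
  have orep: "orbit \<theta> (rep C) = C" if "C \<in> orbit \<theta> ` D" for C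
    using rep[OF that] that orbit_eq_iff[OF perm] by auto
  then have cardR: "card R = card (orbit \<theta> ` D)"
    unfolding R_def by (intro card_image inj_onI) metis
  have RD: "R \<subseteq> D"
    unfolding R_def using rep permutes_orbit_subset[OF \<theta>] by blast
  let ?S = "(D - R) \<rightarrow>\<^sub>E {0..<int N}"
  have "inj_on (\<lambda>h. restrict h (D - R)) ?B"
  proof (rule inj_onI)
    fix h k assume h: "h \<in> ?B" and k: "k \<in> ?B" and eq: "restrict h (D - R) = restrict k (D - R)"
    have off: "h x = k x" if "x \<in> D - R" for x using fun_cong[OF eq, of x] that by simp
    have "h x = k x" if "x \<in> D" for x
    proof (cases "x \<in> R")
      case True
      let ?C = "orbit \<theta> x"
      have "x \<in> ?C" by (rule permutation_self_in_orbit[OF perm])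
      have fin: "finite ?C" and sub: "?C \<subseteq> D"
        using permutes_orbit_image(3)[OF \<theta> D that] permutes_orbit_subset[OF \<theta> that] by auto
      have "y \<notin> R" if "y \<in> ?C - {x}" for y
      proof
        assume "y \<in> R"
        then obtain C where C: "C \<in> orbit \<theta> ` D" "y = rep C" unfolding R_def by blast
        obtain C' where C': "C' \<in> orbit \<theta> ` D" "x = rep C'" using True unfolding R_def by blast
        have "orbit \<theta> y = ?C" using that orbit_eq_iff[OF perm] by blast
        then have "C = C'" using orep C C' by metis
        with C C' that show False by simp
      qed
      then have "(\<Sum>y\<in>?C - {x}. h y) = (\<Sum>y\<in>?C - {x}. k y)"
        by (intro sum.cong) (use off sub in auto)
      then have "(\<Sum>y\<in>?C. h y) - h x = (\<Sum>y\<in>?C. k y) - k x"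
        using fin \<open>x \<in> ?C\<close> by (simp add: sum.remove[of ?C x])
      moreover have "(\<Sum>y\<in>?C. h y) mod int N = (\<Sum>y\<in>?C. k y) mod int N"
        using h k that by auto
      ultimately have "h x mod int N = k x mod int N"
        by (metis (no_types, opaque_lifting) diff_diff_eq2 add_diff_cancel_left' mod_diff_left_eq
            diff_add_cancel)
      moreover have "h x \<in> {0..<int N}" "k x \<in> {0..<int N}" using h k that by blast+
      ultimately show ?thesis by (rule mod_eq_in_range)
    qed (use off that in auto)
    moreover have "h \<in> D \<rightarrow>\<^sub>E {0..<int N}" "k \<in> D \<rightarrow>\<^sub>E {0..<int N}" using h k by blast+
    ultimately show "h = k" by (intro PiE_ext[of h D "\<lambda>_. {0..<int N}" k])
  qed
  moreover have "(\<lambda>h. restrict h (D - R)) ` ?B \<subseteq> ?S"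
    by (intro image_subsetI restrict_PiE_iff[THEN iffD2]) auto
  moreover have "finite ?S" using D by (intro finite_PiE) auto
  ultimately have "card ?B \<le> card ?S" by (rule card_inj_on_le)
  also have "card ?S = N ^ (card D - card (orbit \<theta> ` D))"
    using D RD finite_subset[OF RD D] by (simp add: card_PiE card_Diff_subset cardR)
  finally show ?thesis .
qed

lemma sum_orbit_shift:
  fixes f :: "'a \<Rightarrow> 'b::comm_monoid_add"
  assumes "p permutes D" "finite D" "x \<in> D"
  shows "(\<Sum>y\<in>orbit p x. f (p y)) = (\<Sum>y\<in>orbit p x. f y)"
  using sum.reindex[OF permutes_orbit_image(2)[OF assms], of f] permutes_orbit_image(1)[OF assms]
  by (simp add: o_def)

text \<open>
  A pigeonhole argument that replaces a dimension count. Since \<open>\<theta> \<circ> \<sigma>\<close> is one cycle, the map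
  \<open>f \<mapsto> f - f \<circ> \<theta>\<close> on \<open>\<sigma>\<close>-invariant functions modulo \<open>N\<close> has fibres of at most \<open>N\<close> elements. Hence its
  image has at least \<open>N ^ (card D - card (orbit \<theta> ` D))\<close> elements, which is as many as there are
  functions with sum \<open>0\<close> on each \<open>\<theta>\<close>-orbit.
\<close>

lemma potential_mod:
  fixes h :: "'a \<Rightarrow> int"
  assumes D: "finite D" and \<theta>: "\<theta> permutes D" and \<sigma>: "\<sigma> permutes D"
    and tree: "card (orbit \<theta> ` D) + card (orbit \<sigma> ` D) = card D + 1"
    and one: "\<And>x y. x \<in> D \<Longrightarrow> y \<in> D \<Longrightarrow> y \<in> orbit (\<theta> \<circ> \<sigma>) x"
    and h: "\<And>x. x \<in> D \<Longrightarrow> (\<Sum>y\<in>orbit \<theta> x. h y) = 0" and "N > 0"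
  shows "\<exists>f. \<forall>x\<in>D. f (\<sigma> x) = f x \<and> (f x - f (\<theta> x)) mod int N = h x mod int N"
proof (cases "D = {}")
  case False
  then obtain r where r: "r \<in> D" by blast
  let ?I = "{0..<int N}"
  let ?A = "{f \<in> D \<rightarrow>\<^sub>E ?I. \<forall>x\<in>D. f (\<sigma> x) = f x}"
  let ?B = "{h \<in> D \<rightarrow>\<^sub>E ?I. \<forall>x\<in>D. (\<Sum>y\<in>orbit \<theta> x. h y) mod int N = 0}"
  let ?T = "\<lambda>f. \<lambda>x\<in>D. (f x - f (\<theta> x)) mod int N"
  let ?k = "card D - card (orbit \<theta> ` D)"
  have finA: "finite ?A" and finB: "finite ?B"
    by (rule finite_subset[OF _ finite_PiE[OF D, of "\<lambda>_. ?I"]]; auto)+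
  have balanced: "(\<lambda>x\<in>D. k x mod int N) \<in> ?B" if k: "\<And>x. x \<in> D \<Longrightarrow> (\<Sum>y\<in>orbit \<theta> x. k y) = 0" for k
  proof -
    have "(\<Sum>y\<in>orbit \<theta> x. (\<lambda>x\<in>D. k x mod int N) y) mod int N = 0" if "x \<in> D" for x
    proof -
      have "(\<Sum>y\<in>orbit \<theta> x. (\<lambda>x\<in>D. k x mod int N) y) = (\<Sum>y\<in>orbit \<theta> x. k y mod int N)"
        by (rule sum.cong) (use permutes_orbit_subset[OF \<theta> that] in auto)
      then show ?thesis using k[OF that] by (simp add: mod_sum_eq)
    qed
    with \<open>N > 0\<close> show ?thesis by auto
  qed
  have TA: "?T ` ?A \<subseteq> ?B"
  proof
    fix k assume "k \<in> ?T ` ?A"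
    then obtain f where "k = ?T f" by blast
    then show "k \<in> ?B"
      using balanced[of "\<lambda>x. f x - f (\<theta> x)"] sum_orbit_shift[OF \<theta> D, of _ f]
      by (simp add: sum_subtractf)
  qed
  have "inj_on (\<lambda>f. (?T f, f r)) ?A"
  proof (rule inj_onI)
    fix f k assume f: "f \<in> ?A" and k: "k \<in> ?A" and eq: "(?T f, f r) = (?T k, k r)"
    have T: "(f x - f (\<theta> x)) mod int N = (k x - k (\<theta> x)) mod int N" if "x \<in> D" for x
    proof -
      have "?T f = ?T k" using eq unfolding prod.inject by (rule conjunct1)
      from fun_cong[OF this, of x] that show ?thesis by simp
    qed
    have fr: "f r = k r" using eq unfolding prod.inject by (rule conjunct2)
    have range: "f x \<in> ?I" "k x \<in> ?I" if "x \<in> D" for x using f k that by blast+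
    have walk: "\<theta> (\<sigma> y) \<in> D \<and> f (\<theta> (\<sigma> y)) = k (\<theta> (\<sigma> y))" if y: "y \<in> D" "f y = k y" for y
    proof -
      have in_D: "\<sigma> y \<in> D" "\<theta> (\<sigma> y) \<in> D"
        using y(1) permutes_in_image[OF \<sigma>] permutes_in_image[OF \<theta>] by auto
      have "f (\<sigma> y) = f y" "k (\<sigma> y) = k y" using f k y(1) by blast+
      with y(2) have eq: "f (\<sigma> y) = k (\<sigma> y)" by simp
      have "(f (\<sigma> y) - (f (\<sigma> y) - f (\<theta> (\<sigma> y))) mod int N) mod int N
          = (k (\<sigma> y) - (k (\<sigma> y) - k (\<theta> (\<sigma> y))) mod int N) mod int N"
        unfolding T[OF in_D(1)] unfolding eq by (rule refl)
      then have "f (\<theta> (\<sigma> y)) mod int N = k (\<theta> (\<sigma> y)) mod int N" by (simp add: mod_diff_right_eq)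
      then have "f (\<theta> (\<sigma> y)) = k (\<theta> (\<sigma> y))"
        by (rule mod_eq_in_range) (rule range[OF in_D(2)])+
      with in_D(2) show ?thesis by blast
    qed
    have "y \<in> D \<and> f y = k y" if "y \<in> orbit (\<theta> \<circ> \<sigma>) r" for y
      using that
    proof induct
      case base
      show ?case using walk[OF r fr] by simp
    next
      case (step y)
      then show ?case using walk[of y] by simp
    qed
    then have "f y = k y" if "y \<in> D" for y using one[OF r that] by blast
    moreover have "f \<in> D \<rightarrow>\<^sub>E ?I" "k \<in> D \<rightarrow>\<^sub>E ?I" using f k by blast+
    ultimately show "f = k" by (intro PiE_ext[of f D "\<lambda>_. ?I" k])
  qed
  moreover have "(\<lambda>f. (?T f, f r)) ` ?A \<subseteq> ?T ` ?A \<times> ?I" using r by auto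
  moreover have "finite (?T ` ?A \<times> ?I)" using finA by simp
  ultimately have "card ?A \<le> card (?T ` ?A \<times> ?I)" by (rule card_inj_on_le)
  then have le: "card ?A \<le> card (?T ` ?A) * N" by (simp add: card_cartesian_product)
  have "card (orbit \<sigma> ` D) = Suc ?k"
    using tree card_image_le[OF D, of "orbit \<theta>"] by simp
  then have "N ^ ?k * N = N ^ card (orbit \<sigma> ` D)" by simp
  also have "\<dots> \<le> card ?A" by (rule card_orbit_invariant_functions[OF D \<sigma>])
  also note le
  finally have "N ^ ?k * N \<le> card (?T ` ?A) * N" .
  then have "N ^ ?k \<le> card (?T ` ?A)" using \<open>N > 0\<close> by simp
  moreover have "card ?B \<le> N ^ ?k" by (rule card_orbit_balanced_functions[OF D \<theta>])
  ultimately have "?T ` ?A = ?B" using card_seteq[OF finB TA] by simp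
  with balanced[of h] h have "(\<lambda>x\<in>D. h x mod int N) \<in> ?T ` ?A" by simp
  then obtain f where f: "f \<in> ?A" "(\<lambda>x\<in>D. h x mod int N) = ?T f" by blast
  have "(f x - f (\<theta> x)) mod int N = h x mod int N" if "x \<in> D" for x
    using fun_cong[OF f(2), of x] that by simp
  with f(1) show ?thesis by auto
qed auto

lemma int_eq_of_mod_eq:
  fixes a b :: int
  assumes "a mod N = b mod N" "\<bar>a - b\<bar> < N"
  shows "a = b"
proof -
  have "N dvd a - b" using assms(1) by (simp add: mod_eq_dvd_iff)
  with assms(2) show ?thesis using dvd_imp_le_int[of "a - b" N] by fastforce
qed

text \<open>
  Integrate \<open>h\<close> along the cycle \<open>\<theta> \<circ> \<sigma>\<close>. The result stays between \<open>- card D\<close> and \<open>card D\<close> and agrees with a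
  potential modulo \<open>N\<close>; if \<open>N > 2 * card D + 1\<close>, then the equations modulo \<open>N\<close> are equations.
\<close>

lemma potential_exists:
  fixes h :: "'a \<Rightarrow> int"
  assumes D: "finite D" and \<theta>: "\<theta> permutes D" and \<sigma>: "\<sigma> permutes D"
    and tree: "card (orbit \<theta> ` D) + card (orbit \<sigma> ` D) = card D + 1"
    and one: "\<And>x y. x \<in> D \<Longrightarrow> y \<in> D \<Longrightarrow> y \<in> orbit (\<theta> \<circ> \<sigma>) x"
    and h: "\<And>x. x \<in> D \<Longrightarrow> (\<Sum>y\<in>orbit \<theta> x. h y) = 0"
    and h1: "\<And>x. x \<in> D \<Longrightarrow> \<bar>h x\<bar> \<le> 1"
    and h\<sigma>: "\<And>x. x \<in> D \<Longrightarrow> h (\<sigma> x) = h x"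
  shows "\<exists>L. \<forall>x\<in>D. L (\<sigma> x) = L x \<and> L x - L (\<theta> x) = h x"
proof (cases "D = {}")
  case False
  then obtain r where r: "r \<in> D" by blast
  let ?n = "card D"
  define \<psi> where "\<psi> = \<theta> \<circ> \<sigma>"
  \<comment> \<open>The discrepancies below are at most \<open>2 * card D + 1\<close> in absolute value.\<close>
  define N where "N = int (2 * ?n + 2)"
  obtain f where f: "\<And>x. x \<in> D \<Longrightarrow> f (\<sigma> x) = f x"
    "\<And>x. x \<in> D \<Longrightarrow> (f x - f (\<theta> x)) mod N = h x mod N"
    using potential_mod[OF D \<theta> \<sigma> tree one h, of "2 * ?n + 2"] unfolding N_def by auto
  have \<psi>: "\<psi> permutes D" unfolding \<psi>_def using \<sigma> \<theta> by (rule permutes_compose)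
  have in_D: "\<sigma> x \<in> D" "\<theta> x \<in> D" if "x \<in> D" for x
    using that permutes_in_image[OF \<sigma>] permutes_in_image[OF \<theta>] by auto
  have walk: "(\<psi> ^^ k) r \<in> D \<and> (\<exists>l. \<bar>l\<bar> \<le> int k \<and> l mod N = (f ((\<psi> ^^ k) r) - f r) mod N)" for k
  proof (induct k)
    case 0
    then show ?case using r by (auto intro: exI[of _ 0])
  next
    case (Suc k)
    define y where "y = (\<psi> ^^ k) r"
    obtain l where y: "y \<in> D" and l: "\<bar>l\<bar> \<le> int k" "l mod N = (f y - f r) mod N"
      using Suc by (auto simp: y_def)
    have "(f (\<sigma> y) - f (\<theta> (\<sigma> y))) mod N = h y mod N" using f(2)[of "\<sigma> y"] in_D h\<sigma> y by simp
    then have "(l - h y) mod N = ((f y - f r) - (f y - f (\<theta> (\<sigma> y)))) mod N"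
      using l(2) f(1)[OF y] by (metis mod_diff_cong)
    then have "(l - h y) mod N = (f (\<psi> y) - f r) mod N" by (simp add: \<psi>_def)
    moreover have "\<bar>l - h y\<bar> \<le> int (Suc k)" using l(1) h1[OF y] by simp
    moreover have "\<psi> y \<in> D" using in_D y by (simp add: \<psi>_def)
    ultimately show ?case unfolding y_def by auto
  qed
  have "\<exists>l. \<bar>l\<bar> \<le> int ?n \<and> l mod N = (f x - f r) mod N" if x: "x \<in> D" for x
  proof -
    have orb: "orbit \<psi> r = D"
      using one r unfolding \<psi>_def[symmetric] using permutes_orbit_subset[OF \<psi> r] by blast
    let ?K = "funpow_dist1 \<psi> r r"
    have "r \<in> orbit \<psi> r" using orb r by blast
    then have "D = (\<lambda>k. (\<psi> ^^ k) r) ` {0..<?K}" "inj_on (\<lambda>k. (\<psi> ^^ k) r) {0..<?K}"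
      using orbit_conv_funpow_dist1[of r \<psi>] inj_on_funpow_dist1[of r \<psi> r] orb by auto
    \<comment> \<open>The cycle closes after \<open>card D\<close> steps, so fewer steps lead from \<open>r\<close> to \<open>x\<close>.\<close>
    then have "card D = ?K" "\<exists>k<?K. x = (\<psi> ^^ k) r"
      using card_image x by force+
    then obtain k where k: "k < ?n" "x = (\<psi> ^^ k) r" by auto
    with walk[of k] obtain l where "\<bar>l\<bar> \<le> int k" "l mod N = (f x - f r) mod N" by blast
    with k(1) show ?thesis by (intro exI[of _ l]) simp
  qed
  then obtain L where L: "\<And>x. x \<in> D \<Longrightarrow> \<bar>L x\<bar> \<le> int ?n"
    "\<And>x. x \<in> D \<Longrightarrow> L x mod N = (f x - f r) mod N" by metis
  have "L (\<sigma> x) = L x \<and> L x - L (\<theta> x) = h x" if x: "x \<in> D" for x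
  proof
    show "L (\<sigma> x) = L x"
    proof (rule int_eq_of_mod_eq)
      show "L (\<sigma> x) mod N = L x mod N" using L(2) in_D f(1) x by simp
      show "\<bar>L (\<sigma> x) - L x\<bar> < N" using L(1)[OF x] L(1)[OF in_D(1)[OF x]] by (simp add: N_def)
    qed
    show "L x - L (\<theta> x) = h x"
    proof (rule int_eq_of_mod_eq)
      have "(L x - L (\<theta> x)) mod N = ((f x - f r) - (f (\<theta> x) - f r)) mod N"
        using L(2)[OF x] L(2)[OF in_D(2)[OF x]] by (metis mod_diff_cong)
      then show "(L x - L (\<theta> x)) mod N = h x mod N" using f(2)[OF x] by simp
      show "\<bar>L x - L (\<theta> x) - h x\<bar> < N"
        using L(1)[OF x] L(1)[OF in_D(2)[OF x]] h1[OF x] by (simp add: N_def)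
    qed
  qed
  then show ?thesis by blast
qed auto

section \<open>Dual distances\<close>

primrec face_ball :: "('a \<Rightarrow> 'a) \<Rightarrow> ('a \<Rightarrow> 'a) \<Rightarrow> 'a set \<Rightarrow> nat \<Rightarrow> 'a set" where
  "face_ball \<theta> \<iota> F 0 = F"
| "face_ball \<theta> \<iota> F (Suc k) =
     {x. \<exists>y\<in>orbit (\<theta> \<circ> \<iota>) x. y \<in> face_ball \<theta> \<iota> F k \<or> \<iota> y \<in> face_ball \<theta> \<iota> F k}"

text \<open>
  The distance \<open>d\<close> is the index of the first ball around the face of \<open>r\<close> that contains the half-edge.
  Balls are unions of faces, and \<open>\<iota>\<close> maps each ball into the next one.
\<close>

lemma dual_distance:
  assumes D: "finite D" and \<theta>: "\<theta> permutes D" and \<iota>: "\<iota> permutes D" "\<iota> \<circ> \<iota> = id"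
    and conn: "\<And>S. S \<subseteq> D \<Longrightarrow> S \<noteq> {} \<Longrightarrow> (\<And>x. x \<in> S \<Longrightarrow> \<theta> x \<in> S \<and> \<iota> x \<in> S) \<Longrightarrow> S = D"
    and r: "r \<in> D"
  shows "\<exists>L. \<forall>x\<in>D. 0 \<le> L x \<and> \<bar>L x - L (\<theta> x)\<bar> \<le> (1::int) \<and> L (\<theta> x) = L (\<iota> x) \<and>
    (L x = 0 \<longleftrightarrow> x \<in> orbit (\<theta> \<circ> \<iota>) r) \<and>
    (L x > 0 \<longrightarrow> (\<exists>y\<in>orbit (\<theta> \<circ> \<iota>) x. L y - L (\<theta> y) = 1))"
proof -
  define \<phi> where "\<phi> = \<theta> \<circ> \<iota>"
  have app: "\<phi> x = \<theta> (\<iota> x)" for x by (simp add: \<phi>_def)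
  have \<iota>\<iota>: "\<iota> (\<iota> x) = x" for x using \<iota>(2) by (simp add: fun_eq_iff)
  have \<phi>: "\<phi> permutes D" unfolding \<phi>_def using \<iota>(1) \<theta> by (rule permutes_compose)
  have perm: "permutation \<phi>" using \<phi> D permutation_permutes by blast
  define B where "B = face_ball \<theta> \<iota> (orbit \<phi> r)"
  have B0: "B 0 = orbit \<phi> r" by (simp add: B_def)
  have BS: "x \<in> B (Suc k) \<longleftrightarrow> (\<exists>y\<in>orbit \<phi> x. y \<in> B k \<or> \<iota> y \<in> B k)" for x k
    by (simp add: B_def \<phi>_def)
  have self: "x \<in> orbit \<phi> x" for x by (rule permutation_self_in_orbit[OF perm])
  have in_D: "\<iota> x \<in> D" "\<theta> x \<in> D" "\<phi> x \<in> D" if "x \<in> D" for x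
    using that permutes_in_image[OF \<iota>(1)] permutes_in_image[OF \<theta>] permutes_in_image[OF \<phi>] by auto
  have B\<phi>: "y \<in> B k \<longleftrightarrow> x \<in> B k" if "y \<in> orbit \<phi> x" for x y k
  proof -
    have eq: "orbit \<phi> y = orbit \<phi> x" using that orbit_eq_iff[OF perm] by blast
    show ?thesis
    proof (cases k)
      case 0
      then show ?thesis using eq by (simp add: B0 orbit_eq_iff[OF perm, symmetric])
    next
      case (Suc k)
      then show ?thesis by (simp add: BS eq)
    qed
  qed
  have B\<iota>: "\<iota> x \<in> B (Suc k)" if "x \<in> B k" for x k
    unfolding BS using that by (intro bexI[OF _ self[of "\<iota> x"]]) (simp add: \<iota>\<iota>)
  have sub: "x \<in> D" if "x \<in> B k" for x k
    using that
  proof (induct k arbitrary: x)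
    case 0
    then show ?case using permutes_orbit_subset[OF \<phi> r] by (auto simp: B0)
  next
    case (Suc k)
    then obtain y where y: "y \<in> orbit \<phi> x" "y \<in> D \<or> \<iota> y \<in> D" by (auto simp: BS)
    then have "y \<in> D" using in_D(1)[of "\<iota> y"] \<iota>\<iota> by auto
    have "x \<in> orbit \<phi> y" using y(1) self orbit_swap by metis
    then show ?case using permutes_orbit_subset[OF \<phi> \<open>y \<in> D\<close>] by blast
  qed
  have "(\<Union>k. B k) = D"
  proof (rule conn)
    show "(\<Union>k. B k) \<subseteq> D" using sub by blast
    show "(\<Union>k. B k) \<noteq> {}" using self[of r] B0 by blast
    fix x assume "x \<in> (\<Union>k. B k)"
    then obtain k where k: "x \<in> B k" by blast
    then have "\<iota> x \<in> B (Suc k)" by (rule B\<iota>)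
    moreover have "\<theta> x \<in> orbit \<phi> (\<iota> x)" using orbit.base[of \<phi> "\<iota> x"] by (simp add: app \<iota>\<iota>)
    ultimately show "\<theta> x \<in> (\<Union>k. B k) \<and> \<iota> x \<in> (\<Union>k. B k)" using B\<phi> by blast
  qed
  then have ex: "\<exists>k. x \<in> B k" if "x \<in> D" for x using that by blast
  define d where "d x = (LEAST k. x \<in> B k)" for x
  have dB: "x \<in> B (d x)" if "x \<in> D" for x using LeastI_ex[OF ex[OF that]] by (simp add: d_def)
  have d_le: "d x \<le> k" if "x \<in> B k" for x k using that by (simp add: d_def Least_le)
  have d_face: "d y = d x" if "y \<in> orbit \<phi> x" for x y using B\<phi>[OF that] by (simp add: d_def)
  have d\<theta>: "d (\<theta> x) = d (\<iota> x)" for x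
    using d_face[of "\<theta> x" "\<iota> x"] orbit.base[of \<phi> "\<iota> x"] by (simp add: app \<iota>\<iota>)
  have d\<iota>: "d (\<iota> x) \<le> Suc (d x)" if "x \<in> D" for x using d_le[OF B\<iota>[OF dB[OF that]]] .
  have d\<iota>': "d x \<le> Suc (d (\<iota> x))" if "x \<in> D" for x using d\<iota>[OF in_D(1)[OF that]] \<iota>\<iota> by simp
  show ?thesis
  proof (intro exI[of _ "\<lambda>x. int (d x)"] ballI conjI impI)
    fix x assume x: "x \<in> D"
    show "\<bar>int (d x) - int (d (\<theta> x))\<bar> \<le> 1" using d\<iota>[OF x] d\<iota>'[OF x] d\<theta>[of x] by simp
    show "int (d (\<theta> x)) = int (d (\<iota> x))" using d\<theta> by simp
    show "int (d x) = 0 \<longleftrightarrow> x \<in> orbit (\<theta> \<circ> \<iota>) r"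
    proof -
      have "d x = 0 \<longleftrightarrow> x \<in> B 0" using dB[OF x] d_le[of x 0] by auto
      then show ?thesis unfolding B0 \<phi>_def by simp
    qed
    assume "int (d x) > 0"
    then obtain k where k: "d x = Suc k" by (cases "d x") auto
    then obtain y where y: "y \<in> orbit \<phi> x" "y \<in> B k \<or> \<iota> y \<in> B k"
      using dB[OF x] by (auto simp: BS)
    have "y \<in> D" using permutes_orbit_subset[OF \<phi> x] y(1) by blast
    have dy: "d y = Suc k" using d_face[OF y(1)] k by simp
    then have "y \<notin> B k" using d_le[of y k] by auto
    then have "d (\<iota> y) \<le> k" using y(2) d_le by blast
    then have "d (\<iota> y) = k" using d\<iota>'[OF \<open>y \<in> D\<close>] dy by simp
    with dy d\<theta> y(1) show "\<exists>y\<in>orbit (\<theta> \<circ> \<iota>) x. int (d y) - int (d (\<theta> y)) = 1"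
      unfolding \<phi>_def by (intro bexI[of _ y]) auto
  qed simp
qed

text \<open>
  A face of height \<open>L x > 0\<close> has a neighbour one step lower, so \<open>L\<close> is the length of a path to height
  \<open>0\<close>, and \<open>L'\<close> changes by at most \<open>1\<close> along each edge of this path.
\<close>

lemma dual_distance_le:
  fixes L L' :: "'a \<Rightarrow> int"
  assumes "height_function D \<theta> L" "height_function.geodesic_map D \<theta> L \<iota>"
    and "height_function D \<theta> L'" "height_function.geodesic_map D \<theta> L' \<iota>"
    and zero: "\<And>x. x \<in> D \<Longrightarrow> L x = 0 \<Longrightarrow> L' x = 0" and x: "x \<in> D"
  shows "L' x \<le> L x"
proof -
  interpret A: height_function D \<theta> L by (rule assms(1))
  interpret B: height_function D \<theta> L' by (rule assms(3))
  have mA: "A.matching \<iota>" and mB: "B.matching \<iota>"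
    using assms(2,4) by (simp_all add: A.geodesic_map_def B.geodesic_map_def)
  from x show ?thesis
  proof (induct "nat (L x)" arbitrary: x rule: less_induct)
    case less
    show ?case
    proof (cases "L x = 0")
      case False
      then have "L x > 0" using A.L_nonneg[OF less(2)] by simp
      then obtain y where y: "y \<in> orbit (\<theta> \<circ> \<iota>) x" "A.g y = 1"
        using assms(2) less(2) unfolding A.geodesic_map_def by blast
      have y': "y \<in> D" "L y = L x" "L' y = L' x"
        using A.orbit_face[OF mA less(2) y(1)] B.orbit_face[OF mB less(2) y(1)] by auto
      then have "L (\<theta> y) = L x - 1" "\<theta> y \<in> D" using A.L_\<theta>[of y] y(2) A.\<theta>_in by auto
      then have "L' (\<theta> y) \<le> L x - 1" using less(1)[of "\<theta> y"] \<open>L x > 0\<close> by simp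
      then show ?thesis using B.L_step[OF y'(1)] y'(3) by simp
    qed (use zero less in auto)
  qed
qed

text \<open>
  Following descents, each half-edge is joined to the single face of height \<open>0\<close>.
\<close>

lemma geodesic_map_connected:
  assumes "height_function D \<theta> L" "height_function.geodesic_map D \<theta> L \<iota>"
    and S: "S \<subseteq> D" "S \<noteq> {}" "\<And>x. x \<in> S \<Longrightarrow> \<theta> x \<in> S \<and> \<iota> x \<in> S"
  shows "S = D"
proof -
  interpret height_function D \<theta> L by (rule assms(1))
  have m: "matching \<iota>" using assms(2) by (simp add: geodesic_map_def)
  note m' = matchingD[OF m]
  have orb: "y \<in> S" if "x \<in> S" "y \<in> orbit (\<theta> \<circ> \<iota>) x" for x y
    using that(2,1) by induct (use S(3) in auto)
  have orb': "x \<in> S" if "y \<in> S" "y \<in> orbit (\<theta> \<circ> \<iota>) x" for x y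
    using orb[OF that(1), of x] that(2) self_in_orbit[OF m'(8)] orbit_swap by metis
  have S\<theta>: "x \<in> S" if "\<theta> x \<in> S" for x
    using orb'[OF that, of "\<iota> x"] S(3)[of "\<iota> x"] orbit.base[of "\<theta> \<circ> \<iota>" "\<iota> x"] m'(2)
    by simp
  have down: "\<exists>z\<in>D. L z = 0 \<and> (z \<in> S \<longleftrightarrow> x \<in> S)" if "x \<in> D" for x
    using that
  proof (induct "nat (L x)" arbitrary: x rule: less_induct)
    case less
    show ?case
    proof (cases "L x = 0")
      case False
      then have "L x > 0" using L_nonneg[OF less(2)] by simp
      then obtain y where y: "y \<in> orbit (\<theta> \<circ> \<iota>) x" "g y = 1"
        using assms(2) less(2) unfolding geodesic_map_def by blast
      have y': "y \<in> D" "L y = L x" using orbit_face[OF m less(2) y(1)] by auto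
      then have "L (\<theta> y) = L x - 1" "\<theta> y \<in> D" using L_\<theta>[of y] y(2) \<theta>_in by auto
      then obtain z where "z \<in> D" "L z = 0" "z \<in> S \<longleftrightarrow> \<theta> y \<in> S"
        using less(1)[of "\<theta> y"] \<open>L x > 0\<close> by auto
      moreover have "\<theta> y \<in> S \<longleftrightarrow> x \<in> S" using S(3) S\<theta> orb orb' y(1) by blast
      ultimately show ?thesis by blast
    qed (use less in auto)
  qed
  have same: "y \<in> S" if "x \<in> D" "y \<in> D" "L x = 0" "L y = 0" "x \<in> S" for x y
    using orb[OF that(5)] assms(2) that unfolding geodesic_map_def by blast
  obtain s where s: "s \<in> S" "s \<in> D" using S(1,2) by blast
  obtain r where r: "r \<in> D" "L r = 0" "r \<in> S" using down[OF s(2)] s(1) by blast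
  have "x \<in> S" if "x \<in> D" for x
    using down[OF that] same[OF r(1) _ r(2) _ r(3)] by blast
  with S(1) show ?thesis by blast
qed

section \<open>Transitivity of the generated group\<close>

text \<open>
  A finite set that a permutation maps into itself is also closed under the inverse, so closure
  under the two generators is enough.
\<close>

lemma transitive_imp_connected:
  assumes tr: "generate_transitive n {\<theta>, \<iota>}" and "\<theta> permutes {1..n}" "\<iota> permutes {1..n}"
    and S: "S \<subseteq> {1..n}" "S \<noteq> {}" "\<And>x. x \<in> S \<Longrightarrow> \<theta> x \<in> S \<and> \<iota> x \<in> S"
  shows "S = {1..n}"
proof -
  interpret G: group "sym_group n" by (rule sym_group_is_group)
  have "finite S" using S(1) finite_subset by blast
  have stable: "h x \<in> S" if "h \<in> generate (sym_group n) {\<theta>, \<iota>}" "x \<in> S" for h x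
    using that
  proof (induct arbitrary: x)
    case one
    then show ?case by (simp add: sym_group_one)
  next
    case (incl h)
    with S(3) show ?case by blast
  next
    case (inv h)
    then have h: "h permutes {1..n}" and "h ` S \<subseteq> S" using assms(2,3) S(3) by auto
    then have "h ` S = S"
      using \<open>finite S\<close> permutes_inj[OF h] by (intro endo_inj_surj) (auto intro: inj_on_subset)
    then obtain y where y: "y \<in> S" "x = h y" using inv(2) by blast
    let ?k = "inv\<^bsub>sym_group n\<^esub> h"
    have "?k \<circ> h = id"
      using G.l_inv[of h] h by (simp add: sym_group_carrier sym_group_mult sym_group_one)
    then have "?k x = y" using y(2) by (metis comp_apply id_apply)
    with y(1) show ?case by simp
  next
    case (eng h1 h2)
    then show ?case by (simp add: sym_group_mult)
  qed
  from S(2) obtain s where s: "s \<in> S" by blast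
  have "y \<in> S" if y: "y \<in> {1..n}" for y
  proof -
    obtain h where "h \<in> generate (sym_group n) {\<theta>, \<iota>}" "h s = y"
      using tr s y S(1) unfolding generate_transitive_def by blast
    with stable s show ?thesis by blast
  qed
  with S(1) show ?thesis by blast
qed

lemma connected_imp_transitive:
  assumes p: "\<theta> permutes {1..n}" "\<iota> permutes {1..n}"
    and conn: "\<And>S. S \<subseteq> {1..n} \<Longrightarrow> S \<noteq> {} \<Longrightarrow> (\<And>x. x \<in> S \<Longrightarrow> \<theta> x \<in> S \<and> \<iota> x \<in> S) \<Longrightarrow> S = {1..n}"
  shows "generate_transitive n {\<theta>, \<iota>}"
  unfolding generate_transitive_def
proof (intro ballI)
  interpret G: group "sym_group n" by (rule sym_group_is_group)
  let ?G = "generate (sym_group n) {\<theta>, \<iota>}"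
  fix x y assume x: "x \<in> {1..n}" and y: "y \<in> {1..n}"
  have perm: "h permutes {1..n}" if "h \<in> ?G" for h
    using G.generate_in_carrier[of "{\<theta>, \<iota>}" h] that p by (auto simp: sym_group_carrier)
  have "(\<lambda>h. h x) ` ?G = {1..n}"
  proof (rule conn)
    show "(\<lambda>h. h x) ` ?G \<subseteq> {1..n}"
      using x permutes_in_image[OF perm] by blast
    show "(\<lambda>h. h x) ` ?G \<noteq> {}" using generate.one by blast
    fix z assume "z \<in> (\<lambda>h. h x) ` ?G"
    then obtain h where h: "h \<in> ?G" "z = h x" by blast
    have "\<theta> \<circ> h \<in> ?G" "\<iota> \<circ> h \<in> ?G"
      using generate.eng[OF generate.incl h(1)] by (auto simp: sym_group_mult)
    moreover have "\<theta> z = (\<theta> \<circ> h) x" "\<iota> z = (\<iota> \<circ> h) x" using h(2) by simp_all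
    ultimately show "\<theta> z \<in> (\<lambda>h. h x) ` ?G \<and> \<iota> z \<in> (\<lambda>h. h x) ` ?G" by blast
  qed
  then have "y \<in> (\<lambda>h. h x) ` ?G" using y by (simp only:)
  then show "\<exists>h\<in>?G. h x = y" by blast
qed

section \<open>Pointed maps, labelled mobiles and double Motzkin functions\<close>

(* The simplifier must not turn {1..n} into {Suc 0..n}, where facts about the locale on {1..n}
   no longer match. *)
declare One_nat_def [simp del]

text \<open>
  Maps with a distinguished face, which is encoded by the distances \<open>L\<close> from it.
\<close>

definition labelled_maps :: "nat \<Rightarrow> (nat \<Rightarrow> nat) \<Rightarrow> ((nat \<Rightarrow> nat) \<times> (nat \<Rightarrow> int)) set" where
  "labelled_maps n \<theta> = {(\<iota>, L). \<iota> \<in> Map n \<theta> \<and> L \<in> extensional {1..n} \<and>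
     height_function {1..n} \<theta> L \<and> height_function.geodesic_map {1..n} \<theta> L \<iota>}"

definition labelled_mobiles :: "nat \<Rightarrow> (nat \<Rightarrow> nat) \<Rightarrow> ((nat \<Rightarrow> nat) \<times> (nat \<Rightarrow> int)) set" where
  "labelled_mobiles n \<theta> = {(\<sigma>, L). num_orbits n \<theta> + num_orbits n \<sigma> = n + 1 \<and>
     L \<in> extensional {1..n} \<and> height_function {1..n} \<theta> L \<and> height_function.mobile {1..n} \<theta> L \<sigma>}"

lemma num_orbits_eq_1_iff:
  assumes "n > 0" "p permutes {1..n}"
  shows "num_orbits n p = 1 \<longleftrightarrow> (\<forall>x\<in>{1..n}. \<forall>y\<in>{1..n}. y \<in> orbit p x)"
proof -
  have perm: "permutation p" using assms(2) permutation_permutes by blast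
  have "num_orbits n p = 1 \<longleftrightarrow> is_singleton (orbit p ` {1..n})"
    by (simp add: num_orbits_def perm_orbits_def is_singleton_altdef)
  also have "\<dots> \<longleftrightarrow> (\<forall>x\<in>{1..n}. \<forall>y\<in>{1..n}. orbit p x = orbit p y)"
    (is "_ = ?R")
  proof
    assume ?R
    moreover have "1 \<in> {1..n}" using assms(1) by simp
    ultimately have "orbit p ` {1..n} = {orbit p 1}" by blast
    then show "is_singleton (orbit p ` {1..n})" by (simp add: is_singleton_def)
  next
    assume "is_singleton (orbit p ` {1..n})"
    then obtain C where "orbit p ` {1..n} = {C}" by (auto simp: is_singleton_def)
    then have "orbit p x = C" if "x \<in> {1..n}" for x using that by blast
    then show ?R by metis
  qed
  finally show ?thesis using orbit_eq_iff[OF perm] by blast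
qed


lemma num_orbits_eq_card: "num_orbits n p = card (orbit p ` {1..n})"
  by (simp add: num_orbits_def perm_orbits_def)

text \<open>
  Transitivity comes for free from the heights, and \<open>card_orbits_corresponds\<close> turns Euler's relation
  into the tree relation.
\<close>

lemma geodesic_map_in_Map_iff:
  assumes "height_function {1..n} \<theta> L" "height_function.geodesic_map {1..n} \<theta> L \<iota>"
    and "height_function.corresponds {1..n} \<theta> L \<iota> \<sigma>"
  shows "\<iota> \<in> Map n \<theta> \<longleftrightarrow> num_orbits n \<theta> + num_orbits n \<sigma> = n + 1"
proof -
  interpret height_function "{1..n}" \<theta> L by (rule assms(1))
  have m: "matching \<iota>" using assms(2) by (simp add: geodesic_map_def)
  note m' = matchingD[OF m]
  have ii: "\<iota> \<circ> \<iota> = id" using m by (simp add: matching_def)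
  have "generate_transitive n {\<theta>, \<iota>}"
    using connected_imp_transitive[OF \<theta> m'(1)] geodesic_map_connected[OF assms(1,2)] by blast
  then have "\<iota> \<in> Map n \<theta> \<longleftrightarrow>
      int (num_orbits n \<theta>) - int (num_orbits n \<iota>) + int (num_orbits n (\<theta> \<circ> \<iota>)) = 2"
    using m' ii by (simp add: Map_def)
  moreover have "2 * num_orbits n \<iota> = n"
    using card_orbits_involution[of "{1..n}" \<iota>] m' by (simp add: num_orbits_eq_card)
  moreover have "2 * num_orbits n \<sigma> + 2 = 2 * num_orbits n (\<theta> \<circ> \<iota>) + n"
    using card_orbits_corresponds[OF assms(2,3)] by (simp add: num_orbits_eq_card)
  ultimately show ?thesis by linarith
qed

text \<open>
  The mobile correspondence, performed for each \<open>L\<close> separately.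
\<close>

lemma card_labelled_maps_eq_mobiles: "card (labelled_maps n \<theta>) = card (labelled_mobiles n \<theta>)"
proof -
  let ?H = "height_function {1..n} \<theta>"
  have "\<exists>f. ?H L \<longrightarrow> bij_betw f {\<iota>. height_function.geodesic_map {1..n} \<theta> L \<iota>}
      {\<sigma>. height_function.mobile {1..n} \<theta> L \<sigma>} \<and>
      (\<forall>\<iota>. height_function.geodesic_map {1..n} \<theta> L \<iota> \<longrightarrow>
        height_function.corresponds {1..n} \<theta> L \<iota> (f \<iota>))" for L
  proof (cases "?H L")
    case True
    show ?thesis by (rule height_function.geodesic_mobile_bij[OF True]) blast
  qed blast
  then obtain F where F: "\<And>L. ?H L \<Longrightarrow> bij_betw (F L)
      {\<iota>. height_function.geodesic_map {1..n} \<theta> L \<iota>} {\<sigma>. height_function.mobile {1..n} \<theta> L \<sigma>}"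
    and cor: "\<And>L \<iota>. ?H L \<Longrightarrow> height_function.geodesic_map {1..n} \<theta> L \<iota> \<Longrightarrow>
      height_function.corresponds {1..n} \<theta> L \<iota> (F L \<iota>)"
    by (metis (no_types))
  have "bij_betw (\<lambda>(\<iota>, L). (F L \<iota>, L)) (labelled_maps n \<theta>) (labelled_mobiles n \<theta>)"
    unfolding bij_betw_def
  proof (intro conjI subset_antisym subsetI)
    show "inj_on (\<lambda>(\<iota>, L). (F L \<iota>, L)) (labelled_maps n \<theta>)"
      using F by (auto simp: inj_on_def labelled_maps_def bij_betw_def)
    fix p assume "p \<in> (\<lambda>(\<iota>, L). (F L \<iota>, L)) ` labelled_maps n \<theta>"
    then obtain \<iota> L where p: "p = (F L \<iota>, L)" and q: "(\<iota>, L) \<in> labelled_maps n \<theta>" by auto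
    then have H: "?H L" and geo: "height_function.geodesic_map {1..n} \<theta> L \<iota>"
      by (simp_all add: labelled_maps_def)
    have "height_function.mobile {1..n} \<theta> L (F L \<iota>)" using bij_betwE[OF F[OF H]] geo by blast
    with p q geodesic_map_in_Map_iff[OF H geo cor[OF H geo]] show "p \<in> labelled_mobiles n \<theta>"
      by (simp add: labelled_maps_def labelled_mobiles_def)
  next
    fix p assume "p \<in> labelled_mobiles n \<theta>"
    then obtain \<sigma> L where p: "p = (\<sigma>, L)" "(\<sigma>, L) \<in> labelled_mobiles n \<theta>" by (cases p) auto
    then have H: "?H L" and mob: "height_function.mobile {1..n} \<theta> L \<sigma>"
      by (simp_all add: labelled_mobiles_def)
    have "\<sigma> \<in> F L ` {\<iota>. height_function.geodesic_map {1..n} \<theta> L \<iota>}"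
      using mob unfolding bij_betw_imp_surj_on[OF F[OF H]] by simp
    then obtain \<iota> where geo: "height_function.geodesic_map {1..n} \<theta> L \<iota>" and \<iota>: "F L \<iota> = \<sigma>"
      by blast
    have "(\<iota>, L) \<in> labelled_maps n \<theta>"
      using p(2) geodesic_map_in_Map_iff[OF H geo cor[OF H geo]] geo \<iota>
      by (simp add: labelled_maps_def labelled_mobiles_def)
    then show "p \<in> (\<lambda>(\<iota>, L). (F L \<iota>, L)) ` labelled_maps n \<theta>"
      using p(1) \<iota> by (intro image_eqI[where x = "(\<iota>, L)"]) auto
  qed
  then show ?thesis by (rule bij_betw_same_card)
qed

lemma labelled_map_exists:
  assumes \<theta>: "\<theta> permutes {1..n}" and \<iota>: "\<iota> \<in> Map n \<theta>" and C: "C \<in> perm_orbits n (\<theta> \<circ> \<iota>)"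
  shows "\<exists>L. (\<iota>, L) \<in> labelled_maps n \<theta> \<and> {x \<in> {1..n}. L x = 0} = C"
proof -
  have p: "\<iota> permutes {1..n}" "\<iota> \<circ> \<iota> = id" and fpf: "\<And>x. x \<in> {1..n} \<Longrightarrow> \<iota> x \<noteq> x"
    and tr: "generate_transitive n {\<theta>, \<iota>}"
    using \<iota> unfolding Map_def mem_Collect_eq by simp_all
  have perm: "permutation (\<theta> \<circ> \<iota>)"
    using permutes_compose[OF p(1) \<theta>] permutation_permutes by blast
  obtain r where r: "r \<in> {1..n}" "C = orbit (\<theta> \<circ> \<iota>) r" using C by (auto simp: perm_orbits_def)
  obtain K :: "nat \<Rightarrow> int" where "\<forall>x\<in>{1..n}. 0 \<le> K x \<and> \<bar>K x - K (\<theta> x)\<bar> \<le> 1 \<and>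
      K (\<theta> x) = K (\<iota> x) \<and> (K x = 0 \<longleftrightarrow> x \<in> orbit (\<theta> \<circ> \<iota>) r) \<and>
      (K x > 0 \<longrightarrow> (\<exists>y\<in>orbit (\<theta> \<circ> \<iota>) x. K y - K (\<theta> y) = 1))"
    using dual_distance[OF finite_atLeastAtMost \<theta> p transitive_imp_connected[OF tr \<theta> p(1)] r(1)]
    by (rule exE)
  then have K: "\<And>x. x \<in> {1..n} \<Longrightarrow> 0 \<le> K x"
    "\<And>x. x \<in> {1..n} \<Longrightarrow> \<bar>K x - K (\<theta> x)\<bar> \<le> 1" "\<And>x. x \<in> {1..n} \<Longrightarrow> K (\<theta> x) = K (\<iota> x)"
    "\<And>x. x \<in> {1..n} \<Longrightarrow> K x = 0 \<longleftrightarrow> x \<in> orbit (\<theta> \<circ> \<iota>) r"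
    "\<And>x. x \<in> {1..n} \<Longrightarrow> K x > 0 \<Longrightarrow> \<exists>y\<in>orbit (\<theta> \<circ> \<iota>) x. K y - K (\<theta> y) = 1"
    by blast+
  define L where "L = restrict K {1..n}"
  have L: "L x = K x" "L (\<theta> x) = K (\<theta> x)" "L (\<iota> x) = K (\<iota> x)" if "x \<in> {1..n}" for x
    using that permutes_in_image[OF \<theta>] permutes_in_image[OF p(1)] by (simp_all add: L_def)
  have sub: "orbit (\<theta> \<circ> \<iota>) x \<subseteq> {1..n}" if "x \<in> {1..n}" for x
    by (rule permutes_orbit_subset[OF permutes_compose[OF p(1) \<theta>] that])
  have H: "height_function {1..n} \<theta> L"
  proof
    show "\<exists>x\<in>{1..n}. L x = 0"
      using K(4)[OF r(1)] L(1)[OF r(1)] r(1) permutation_self_in_orbit[OF perm] by auto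
    fix x assume x: "x \<in> {1..n}"
    show "0 \<le> L x" using K(1)[OF x] L(1)[OF x] by simp
    show "\<bar>L x - L (\<theta> x)\<bar> \<le> 1" using K(2)[OF x] L[OF x] by simp
  qed (use \<theta> in simp_all)
  interpret height_function "{1..n}" \<theta> L by (rule H)
  have "matching \<iota>" unfolding matching_def using p fpf K(3) L by metis
  moreover have "y \<in> orbit (\<theta> \<circ> \<iota>) x"
    if "x \<in> {1..n}" "y \<in> {1..n}" "L x = 0" "L y = 0" for x y
    using that K(4) L(1) orbit_eq_iff[OF perm] by metis
  moreover have "\<exists>y\<in>orbit (\<theta> \<circ> \<iota>) x. g y = 1" if x: "x \<in> {1..n}" "L x > 0" for x
    using K(5)[OF x(1)] x L sub[OF x(1)] unfolding g_def by (metis subsetD)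
  ultimately have "geodesic_map \<iota>" unfolding geodesic_map_def by blast
  then have "(\<iota>, L) \<in> labelled_maps n \<theta>"
    using \<iota> H by (simp add: labelled_maps_def L_def)
  moreover have "{x \<in> {1..n}. L x = 0} = C"
    using K(4) L(1) sub[OF r(1)] unfolding r(2) by (auto simp del: atLeastAtMost_iff)
  ultimately show ?thesis by blast
qed

lemma inj_on_second_componentI:
  assumes "\<And>a b b'. (a, b) \<in> S \<Longrightarrow> (a, b') \<in> S \<Longrightarrow> f b = f b' \<Longrightarrow> b = b'"
  shows "inj_on (\<lambda>(a, b). (a, f b)) S"
proof (rule inj_onI)
  fix p q assume pq: "p \<in> S" "q \<in> S" and eq: "(\<lambda>(a, b). (a, f b)) p = (\<lambda>(a, b). (a, f b)) q"
  obtain a b a' b' where "p = (a, b)" "q = (a', b')" by (cases p, cases q)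
  with pq eq assms[of a b b'] show "p = q" by simp
qed

text \<open>
  Heights are distances and so are determined by the face of height \<open>0\<close>, which can be any face.
\<close>

lemma card_labelled_maps:
  assumes \<theta>: "\<theta> permutes {1..n}"
  shows "card (labelled_maps n \<theta>) = (\<Sum>\<iota>\<in>Map n \<theta>. num_orbits n (\<theta> \<circ> \<iota>))"
proof -
  let ?Z = "\<lambda>L :: nat \<Rightarrow> int. {x \<in> {1..n}. L x = 0}"
  let ?S = "SIGMA \<iota>:Map n \<theta>. perm_orbits n (\<theta> \<circ> \<iota>)"
  have "bij_betw (\<lambda>(\<iota>, L). (\<iota>, ?Z L)) (labelled_maps n \<theta>) ?S"
    unfolding bij_betw_def
  proof (intro conjI subset_antisym subsetI)
    show "inj_on (\<lambda>(\<iota>, L). (\<iota>, ?Z L)) (labelled_maps n \<theta>)"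
    proof (rule inj_on_second_componentI)
      fix \<iota> L L' assume L: "(\<iota>, L) \<in> labelled_maps n \<theta>" and L': "(\<iota>, L') \<in> labelled_maps n \<theta>"
        and eq: "?Z L = ?Z L'"
      show "L = L'"
      proof (rule extensionalityI[of _ "{1..n}"])
        fix x assume "x \<in> {1..n}"
        then have "L' x \<le> L x" "L x \<le> L' x"
          using L L' eq dual_distance_le[of "{1..n}" \<theta> L \<iota> L' x]
            dual_distance_le[of "{1..n}" \<theta> L' \<iota> L x]
          unfolding labelled_maps_def by blast+
        then show "L x = L' x" by simp
      qed (use L L' in \<open>auto simp: labelled_maps_def\<close>)
    qed
    fix p assume "p \<in> (\<lambda>(\<iota>, L). (\<iota>, ?Z L)) ` labelled_maps n \<theta>"
    then obtain \<iota> L where p: "p = (\<iota>, ?Z L)" and L: "(\<iota>, L) \<in> labelled_maps n \<theta>"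
      by (elim imageE) (simp split: prod.splits)
    then have H: "height_function {1..n} \<theta> L" by (simp add: labelled_maps_def)
    interpret height_function "{1..n}" \<theta> L by (rule H)
    have geo: "geodesic_map \<iota>" using L by (simp add: labelled_maps_def)
    then have m: "matching \<iota>" by (simp add: geodesic_map_def)
    obtain r where r: "r \<in> {1..n}" "L r = 0" using L_zero by blast
    have "?Z L = orbit (\<theta> \<circ> \<iota>) r"
    proof
      show "?Z L \<subseteq> orbit (\<theta> \<circ> \<iota>) r" using geo r unfolding geodesic_map_def by blast
      show "orbit (\<theta> \<circ> \<iota>) r \<subseteq> ?Z L" using orbit_face[OF m r(1)] r(2) by auto
    qed
    with r(1) L p show "p \<in> ?S" by (auto simp: perm_orbits_def labelled_maps_def)
  next
    fix p assume "p \<in> ?S"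
    then obtain \<iota> C where p: "p = (\<iota>, C)" "\<iota> \<in> Map n \<theta>" "C \<in> perm_orbits n (\<theta> \<circ> \<iota>)" by blast
    from labelled_map_exists[OF \<theta> p(2,3)] obtain L
      where "(\<iota>, L) \<in> labelled_maps n \<theta>" "?Z L = C" by blast
    with p(1) show "p \<in> (\<lambda>(\<iota>, L). (\<iota>, ?Z L)) ` labelled_maps n \<theta>"
      by (intro image_eqI[where x = "(\<iota>, L)"]) auto
  qed
  then have "card (labelled_maps n \<theta>) = card ?S" by (rule bij_betw_same_card)
  also have "\<dots> = (\<Sum>\<iota>\<in>Map n \<theta>. num_orbits n (\<theta> \<circ> \<iota>))"
    using finite_Map by (subst card_SigmaI) (auto simp: num_orbits_def perm_orbits_def)
  finally show ?thesis .
qed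

lemma mobile_in_GJdM:
  assumes "n > 0" and "(\<sigma>, L) \<in> labelled_mobiles n \<theta>"
  shows "(\<sigma>, \<lambda>x\<in>{1..n}. L x - L (\<theta> x)) \<in> GJdM n \<theta>"
proof -
  let ?g = "\<lambda>x\<in>{1..n}. L x - L (\<theta> x)"
  have tree: "num_orbits n \<theta> + num_orbits n \<sigma> = n + 1"
    and H: "height_function {1..n} \<theta> L" and mob: "height_function.mobile {1..n} \<theta> L \<sigma>"
    using assms(2) by (auto simp: labelled_mobiles_def)
  interpret height_function "{1..n}" \<theta> L by (rule H)
  note M = mobileD[OF mob]
  have g: "?g x = g x" if "x \<in> {1..n}" for x using that by (simp add: g_def)
  have "num_orbits n (\<theta> \<circ> \<sigma>) = 1"
    using num_orbits_eq_1_iff[OF \<open>n > 0\<close> permutes_compose[OF M(1) \<theta>]] M(8) by blast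
  with tree M(1) \<theta> have GJ: "(\<theta>, \<sigma>) \<in> GJ n" by (simp add: GJ_def)
  have "(\<Sum>i\<in>C. real_of_int (?g i)) / real (card C) = 0" if C: "C \<in> perm_orbits n \<theta>" for C
  proof -
    obtain x where x: "x \<in> {1..n}" "C = orbit \<theta> x" using C by (auto simp: perm_orbits_def)
    have "(\<Sum>i\<in>C. ?g i) = (\<Sum>i\<in>C. L i - L (\<theta> i))"
      by (rule sum.cong) (use permutes_orbit_subset[OF \<theta> x(1)] x(2) in auto)
    also have "\<dots> = 0"
      using sum_orbit_shift[OF \<theta> finite_D x(1), of L] x(2) by (simp add: sum_subtractf)
    finally have "real_of_int (\<Sum>i\<in>C. ?g i) = 0" by (simp only: of_int_0)
    then show ?thesis by (simp only: of_int_sum div_0)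
  qed
  moreover have "?g \<circ> \<sigma> = ?g"
  proof
    fix x
    show "(?g \<circ> \<sigma>) x = ?g x"
    proof (cases "x \<in> {1..n}")
      case True
      then show ?thesis using g[OF True] g[OF M(2)[OF True]] M(4)[OF True] by simp
    next
      case False
      then show ?thesis using permutes_not_in[OF M(1) False] by simp
    qed
  qed
  moreover have "\<bar>?g x\<bar> \<le> 1" if "x \<in> {1..n}" for x using L_step[OF that] that by simp
  moreover have "level_set n ?g c = {x \<in> {1..n}. g x = c}" for c
    using g by (auto simp: level_set_def)
  then have "level_set n ?g (-1) \<inter> supp n \<sigma> = {}" "level_set n ?g 0 \<inter> supp n (\<sigma> \<circ> \<sigma>) = {}"
    "level_set n ?g 0 \<subseteq> supp n \<sigma>"
    using M(5,6,7) by (auto simp: supp_def)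
  moreover have "?g \<in> {1..n} \<rightarrow>\<^sub>E UNIV" by simp
  ultimately have "?g \<in> dMotz n \<theta> \<sigma>" unfolding dMotz_def by (intro CollectI conjI ballI)
  with GJ M(1) show ?thesis by (simp add: GJdM_def)
qed

text \<open>
  The two heights have the same increments along the single contour cycle; so they differ by a
  constant, which vanishes because both have minimum \<open>0\<close>.
\<close>

lemma mobile_determined_by_differences:
  assumes "(\<sigma>, L) \<in> labelled_mobiles n \<theta>" "(\<sigma>, L') \<in> labelled_mobiles n \<theta>"
    and eq: "\<And>x. x \<in> {1..n} \<Longrightarrow> L x - L (\<theta> x) = L' x - L' (\<theta> x)"
  shows "L = L'"
proof -
  have H: "height_function {1..n} \<theta> L" "height_function {1..n} \<theta> L'"
    and mob: "height_function.mobile {1..n} \<theta> L \<sigma>" "height_function.mobile {1..n} \<theta> L' \<sigma>"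
    and ext: "L \<in> extensional {1..n}" "L' \<in> extensional {1..n}"
    using assms(1,2) by (auto simp: labelled_mobiles_def)
  interpret A: height_function "{1..n}" \<theta> L by (rule H(1))
  interpret B: height_function "{1..n}" \<theta> L' by (rule H(2))
  note M = A.mobileD[OF mob(1)] and M' = B.mobileD[OF mob(2)]
  have geq: "A.g x = B.g x" if "x \<in> {1..n}" for x
    using eq[OF that] by (simp add: A.g_def B.g_def)
  have const: "L y - L' y = L x - L' x" if "x \<in> {1..n}" "y \<in> {1..n}" for x y
  proof -
    have "y \<in> {1..n} \<and> L y - L' y = L x - L' x"
    proof (rule orbit_closed[OF M(8)[OF that], of "\<lambda>y. y \<in> {1..n} \<and> L y - L' y = L x - L' x"])
      fix z assume z: "z \<in> {1..n} \<and> L z - L' z = L x - L' x"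
      then have "\<theta> (\<sigma> z) \<in> {1..n}" using M(2) A.\<theta>_in by blast
      with z M(9)[of z] M'(9)[of z] geq[of z]
      show "(\<theta> \<circ> \<sigma>) z \<in> {1..n} \<and> L ((\<theta> \<circ> \<sigma>) z) - L' ((\<theta> \<circ> \<sigma>) z) = L x - L' x"
        by simp
    qed (use that in simp)
    then show ?thesis ..
  qed
  obtain r where r: "r \<in> {1..n}" "L r = 0" using A.L_zero by blast
  obtain s where s: "s \<in> {1..n}" "L' s = 0" using B.L_zero by blast
  have "L x = L' x" if "x \<in> {1..n}" for x
    using const[OF r(1) that] const[OF s(1) that] r(2) s(2)
      A.L_nonneg[OF s(1)] B.L_nonneg[OF r(1)] by simp
  with ext show ?thesis by (intro extensionalityI)
qed

text \<open>
  The orbits form a tree, so \<open>h\<close> has a potential; the conditions on the level sets of \<open>h\<close> say how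
  \<open>\<sigma>\<close> acts on half-edges with \<open>g = -1\<close> and \<open>g = 0\<close>.
\<close>

lemma mobile_of_GJdM:
  assumes "n > 0" and "(\<sigma>, h) \<in> GJdM n \<theta>"
  shows "\<exists>L. (\<sigma>, L) \<in> labelled_mobiles n \<theta> \<and> (\<lambda>x\<in>{1..n}. L x - L (\<theta> x)) = h"
proof -
  have \<sigma>: "\<sigma> permutes {1..n}" and \<theta>: "\<theta> permutes {1..n}"
    and tree: "num_orbits n \<theta> + num_orbits n \<sigma> = n + 1" and "num_orbits n (\<theta> \<circ> \<sigma>) = 1"
    and h: "h \<in> dMotz n \<theta> \<sigma>"
    using assms(2) by (auto simp: GJdM_def GJ_def)
  then have one: "y \<in> orbit (\<theta> \<circ> \<sigma>) x" if "x \<in> {1..n}" "y \<in> {1..n}" for x y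
    using num_orbits_eq_1_iff[OF \<open>n > 0\<close> permutes_compose[OF \<sigma> \<theta>]] that by blast
  have ext: "h \<in> extensional {1..n}" and h1: "\<And>x. x \<in> {1..n} \<Longrightarrow> \<bar>h x\<bar> \<le> 1"
    and avg: "\<And>C. C \<in> perm_orbits n \<theta> \<Longrightarrow> (\<Sum>i\<in>C. real_of_int (h i)) / real (card C) = 0"
    and h\<sigma>: "h \<circ> \<sigma> = h"
    and lev: "level_set n h (-1) \<inter> supp n \<sigma> = {}" "level_set n h 0 \<inter> supp n (\<sigma> \<circ> \<sigma>) = {}"
      "level_set n h 0 \<subseteq> supp n \<sigma>"
    using h by (auto simp: dMotz_def PiE_def)
  have sum0: "(\<Sum>y\<in>orbit \<theta> x. h y) = 0" if x: "x \<in> {1..n}" for x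
  proof -
    have "card (orbit \<theta> x) \<noteq> 0"
      using permutes_orbit_image(3)[OF \<theta> finite_atLeastAtMost x] orbit_nonempty[of \<theta> x]
      by (simp only: card_eq_0_iff not_False_eq_True de_Morgan_disj simp_thms)
    moreover have "(\<Sum>i\<in>orbit \<theta> x. real_of_int (h i)) / real (card (orbit \<theta> x)) = 0"
      using avg x by (simp add: perm_orbits_def)
    ultimately have "real_of_int (\<Sum>y\<in>orbit \<theta> x. h y) = 0" by simp
    then show ?thesis by (simp only: of_int_eq_0_iff)
  qed
  have h\<sigma>': "h (\<sigma> x) = h x" for x using h\<sigma> by (metis comp_apply)
  have "card (orbit \<theta> ` {1..n}) + card (orbit \<sigma> ` {1..n}) = card {1..n} + 1"
    using tree by (simp add: num_orbits_eq_card)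
  from potential_exists[OF finite_atLeastAtMost \<theta> \<sigma> this one sum0 h1 h\<sigma>']
  obtain P where "\<forall>x\<in>{1..n}. P (\<sigma> x) = P x \<and> P x - P (\<theta> x) = h x" by blast
  then have P: "\<And>x. x \<in> {1..n} \<Longrightarrow> P (\<sigma> x) = P x"
    "\<And>x. x \<in> {1..n} \<Longrightarrow> P x - P (\<theta> x) = h x" by blast+
  \<comment> \<open>Shift the potential so that its minimum becomes \<open>0\<close>.\<close>
  define m where "m = Min (P ` {1..n})"
  have m: "m \<le> P x" if "x \<in> {1..n}" for x using that by (simp add: m_def)
  have "m \<in> P ` {1..n}" unfolding m_def using \<open>n > 0\<close> by (intro Min_in) auto
  then obtain r where r: "r \<in> {1..n}" "P r = m" by blast
  define L where "L = (\<lambda>x\<in>{1..n}. P x - m)"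
  have in_D: "\<theta> x \<in> {1..n}" "\<sigma> x \<in> {1..n}" if "x \<in> {1..n}" for x
    using that permutes_in_image[OF \<theta>] permutes_in_image[OF \<sigma>] by blast+
  have L: "L x = P x - m" "L (\<theta> x) = P (\<theta> x) - m" "L (\<sigma> x) = P (\<sigma> x) - m"
    if "x \<in> {1..n}" for x
    using that in_D[OF that] by (simp_all add: L_def)
  have diff: "L x - L (\<theta> x) = h x" if "x \<in> {1..n}" for x
    using L[OF that] P(2)[OF that] by simp
  have H: "height_function {1..n} \<theta> L"
  proof
    show "\<exists>x\<in>{1..n}. L x = 0" using r L(1) by (intro bexI[of _ r]) auto
  qed (use \<theta> m L(1) diff h1 in auto)
  interpret height_function "{1..n}" \<theta> L by (rule H)
  have g: "g x = h x" if "x \<in> {1..n}" for x using diff[OF that] by (simp add: g_def)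
  have "mobile \<sigma>"
    unfolding mobile_def
  proof (intro conjI ballI impI)
    fix x assume x: "x \<in> {1..n}"
    show "L (\<sigma> x) = L x" using L[OF x] P(1)[OF x] by simp
    show "g (\<sigma> x) = g x" using g[OF x] g[OF in_D(2)[OF x]] h\<sigma>' by simp
    show "\<sigma> x = x" if "g x = -1"
      using that g[OF x] x lev(1) by (auto simp: level_set_def supp_def)
    show "\<sigma> x \<noteq> x" "\<sigma> (\<sigma> x) = x" if "g x = 0"
      using that g[OF x] x lev(2,3) by (auto simp: level_set_def supp_def)
  qed (use \<sigma> one in auto)
  with tree H have "(\<sigma>, L) \<in> labelled_mobiles n \<theta>" by (simp add: labelled_mobiles_def L_def)
  moreover have "(\<lambda>x\<in>{1..n}. L x - L (\<theta> x)) = h"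
    by (rule extensionalityI[OF _ ext]) (use diff in auto)
  ultimately show ?thesis by blast
qed

lemma card_labelled_mobiles:
  assumes "n > 0"
  shows "card (labelled_mobiles n \<theta>) = card (GJdM n \<theta>)"
proof -
  let ?d = "\<lambda>L :: nat \<Rightarrow> int. \<lambda>x\<in>{1..n}. L x - L (\<theta> x)"
  have "bij_betw (\<lambda>(\<sigma>, L). (\<sigma>, ?d L)) (labelled_mobiles n \<theta>) (GJdM n \<theta>)"
    unfolding bij_betw_def
  proof (intro conjI subset_antisym subsetI)
    show "inj_on (\<lambda>(\<sigma>, L). (\<sigma>, ?d L)) (labelled_mobiles n \<theta>)"
    proof (rule inj_on_second_componentI)
      fix \<sigma> L L' assume *: "(\<sigma>, L) \<in> labelled_mobiles n \<theta>" "(\<sigma>, L') \<in> labelled_mobiles n \<theta>"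
        and eq: "?d L = ?d L'"
      show "L = L'"
      proof (rule mobile_determined_by_differences[OF *])
        show "L x - L (\<theta> x) = L' x - L' (\<theta> x)" if "x \<in> {1..n}" for x
          using fun_cong[OF eq, of x] that by simp
      qed
    qed
    show "p \<in> GJdM n \<theta>" if "p \<in> (\<lambda>(\<sigma>, L). (\<sigma>, ?d L)) ` labelled_mobiles n \<theta>" for p
      using that mobile_in_GJdM[OF assms] by auto
    show "p \<in> (\<lambda>(\<sigma>, L). (\<sigma>, ?d L)) ` labelled_mobiles n \<theta>"
      if mem: "p \<in> GJdM n \<theta>" for p
    proof -
      obtain \<sigma> h where p: "p = (\<sigma>, h)" by (cases p)
      obtain L where "(\<sigma>, L) \<in> labelled_mobiles n \<theta>" "?d L = h"
        using mobile_of_GJdM[OF assms] mem p by blast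
      with p show ?thesis by (intro image_eqI[where x = "(\<sigma>, L)"]) auto
    qed
  qed
  then show ?thesis by (rule bij_betw_same_card)
qed

lemma num_faces:
  assumes "\<iota> \<in> Map n \<theta>"
  shows "real (num_orbits n (\<theta> \<circ> \<iota>)) = real n / 2 - real (num_orbits n \<theta>) + 2"
proof -
  have "2 * num_orbits n \<iota> = n"
    unfolding num_orbits_eq_card
    by (subst card_orbits_involution)
      (use assms permutes_in_image[of \<iota> "{1..n}"] in \<open>auto simp: Map_def fun_eq_iff\<close>)
  moreover have "int (num_orbits n \<theta>) - int (num_orbits n \<iota>) + int (num_orbits n (\<theta> \<circ> \<iota>)) = 2"
    using assms by (simp add: Map_def)
  ultimately show ?thesis by linarith
qed

theorem theorem1p2p5:
  fixes n :: nat and \<theta> :: "nat \<Rightarrow> nat"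
  assumes "n > 0"
    and "\<theta> permutes {1..n}"
    and "real n / 2 - real (num_orbits n \<theta>) + 2 > 0"
  shows "real (card (Map n \<theta>)) =
    real (card (GJdM n \<theta>)) / (real n / 2 - real (num_orbits n \<theta>) + 2)"
proof -
  let ?F = "real n / 2 - real (num_orbits n \<theta>) + 2"
  have "card (GJdM n \<theta>) = (\<Sum>\<iota>\<in>Map n \<theta>. num_orbits n (\<theta> \<circ> \<iota>))"
    using card_labelled_mobiles[OF assms(1)] card_labelled_maps_eq_mobiles
      card_labelled_maps[OF assms(2)] by simp
  then have "real (card (GJdM n \<theta>)) = (\<Sum>\<iota>\<in>Map n \<theta>. real (num_orbits n (\<theta> \<circ> \<iota>)))"
    by simp
  also have "\<dots> = (\<Sum>\<iota>\<in>Map n \<theta>. ?F)" by (rule sum.cong[OF refl num_faces])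
  also have "\<dots> = real (card (Map n \<theta>)) * ?F" by simp
  finally show ?thesis using assms(3) by simp
qed

end
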